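(* Let $p$ be a prime and $K$ a complete discretely valued field with normalized valuation and finite residue field of characteristic $p$. Let $L=K(x)/K$ be a typical extension, where $x^p-\alpha^{(p-1)/d}x=\beta$ with data as follows: $d=ef\mid p-1$; integers $0\le t<e$ with $\gcd(t,e)=1$ and $b$ with $\gcd(b,p)=1$ and $0<b+pt/e<v_L(p)/(p-1)$; $\beta\in K$ with $v_K(\beta)=-b$; $\alpha=\pi_K^{ft}\gamma^f\mu$ with $\pi_K$ a prime element of $K$ and $\gamma,\mu\in\mathfrak O_K^\times$, the image of $\mu$ representing a coset of order $f$ in $\kappa^\times/(\kappa^\times)^f$. Let $\ell=b+pt/e$ be the ramification number of $L/K$. Let $M=K(x,y)$, $y^d=\alpha$, be the Galois closure of $L/K$, and let $\sigma\in\mathrm{Gal}(M/K)$ be the automorphism of order $p$ with $\sigma(y)=y$ and $\sigma(x)=x+y+y\Delta$, where $\Delta=0$ if $\mathrm{char}(K)=p$ and $\Delta\in M$ with $v_M(\Delta)=v_M(p)-(p-1)e\ell$ if $\mathrm{char}(K)=0$. Let $s=(p-1)/d$, let $r_0$ be a primitive root modulo $p$, and let $\rho_0=r_0\in\mathbb F_p\subset K$ if $\mathrm{char}(K)=p$, resp. $\rho_0\in\mathbb Z_p$ the Teichmüller representative of $r_0$ (primitive $(p-1)$-th root of unity with $\rho_0\equiv r_0\bmod p$) if $\mathrm{char}(K)=0$. Define $$\Psi=-\frac{1}{y}\sum_{k=0}^{p-2}\rho_0^{-k}\sigma^{r_0^{k}}\in M[\langle\sigma\rangle],$$ acting on $M$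 in the natural way. Then $\Psi\cdot 1=0$, and for $1\le i\le p-1$ we have $\Psi\cdot x^i\in L$; more precisely, $$\Psi\cdot x^i=ix^{i-1}\quad\text{if }\mathrm{char}(K)=p,$$ $$\Psi\cdot x^i\equiv ix^{i-1}\bmod x^{i-1}\mathfrak P_L^{\,v_L(p)-(p-1)\ell}\quad\text{if }\mathrm{char}(K)=0.$$
   Context: For a finite extension $F$ of $K$, $v_F$ is the normalized valuation ($v_F(F^\times)=\mathbb Z$), $\mathfrak O_F$ the ring of integers, $\mathfrak P_F$ the maximal ideal, $\kappa$ the residue field of $K$. A ramified extension $L/K$ of degree $p$ is typical if it is not generated by a $p$-th root of a prime element of $K$. Ramification numbers use Serre's normalization, defined for non-Galois $L/K$ as the largest upper ramification break of the Galois group of the Galois closure. The congruence $A\equiv B\bmod x^{i-1}\mathfrak P_L^{n}$ means $A-B\in x^{i-1}\mathfrak P_L^n$.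
   Formalization: The prime p is assumed odd: for p = 2 the sum defining Ψ has the single term k = 0, so Ψ = -(1/y)σ and Ψ·1 = -1/y ≠ 0, and the claim always fails (e.g. K = F_2((T)), x^2 - x = 1/T, y = 1). *)

theory Defs
  imports
    "HOL-Analysis.Analysis"
    "HOL-Algebra.Algebra"
    "HOL-Algebra.Algebraic_Closure_Type"
    "HOL-Number_Theory.Residue_Primitive_Roots"
    "HOL-Library.Poly_Mapping"
begin

text \<open>
  All fields are subfields of one ambient field, which is a type of class field;
  HOL-Algebra sees it through \<^const>\<open>ring_of_type_algebra\<close>.
\<close>

abbreviation amb :: "'a::field ring" where
  "amb \<equiv> ring_of_type_algebra"

definition adjoin :: "'a::field set \<Rightarrow> 'a set \<Rightarrow> 'a set" where
  "adjoin K S = generate_field amb (K \<union> S)"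


section \<open>Discretely valued fields\<close>

text \<open>Valuations are extended-real valued with value \<open>\<infinity>\<close> at \<open>0\<close>; values outside \<open>F\<close> are irrelevant.\<close>

definition normalized_valuation :: "'a::field set \<Rightarrow> ('a \<Rightarrow> ereal) \<Rightarrow> bool" where
  "normalized_valuation F v \<longleftrightarrow>
     v 0 = \<infinity> \<and>
     v ` (F - {0}) = range (\<lambda>n::int. ereal (real_of_int n)) \<and>
     (\<forall>a\<in>F. \<forall>b\<in>F. v (a * b) = v a + v b) \<and>
     (\<forall>a\<in>F. \<forall>b\<in>F. min (v a) (v b) \<le> v (a + b))"

definition valuation_ring :: "'a::field set \<Rightarrow> ('a \<Rightarrow> ereal) \<Rightarrow> 'a set" where
  "valuation_ring F v = {a \<in> F. 0 \<le> v a}"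

text \<open>The fractional ideal \<open>\<PP>\<^sub>F\<^sup>n\<close>; the exponent is an extended real because it will be
  of the form \<open>v(p) - c\<close>.\<close>

definition prime_power_ideal :: "'a::field set \<Rightarrow> ('a \<Rightarrow> ereal) \<Rightarrow> ereal \<Rightarrow> 'a set" where
  "prime_power_ideal F v n = {a \<in> F. n \<le> v a}"

definition valuation_units :: "'a::field set \<Rightarrow> ('a \<Rightarrow> ereal) \<Rightarrow> 'a set" where
  "valuation_units F v = {a \<in> valuation_ring F v. \<exists>b \<in> valuation_ring F v. a * b = 1}"

definition prime_element :: "'a::field set \<Rightarrow> ('a \<Rightarrow> ereal) \<Rightarrow> 'a \<Rightarrow> bool" where
  "prime_element F v a \<longleftrightarrow> a \<in> F \<and> v a = 1"

definition complete_wrt :: "'a::field set \<Rightarrow> ('a \<Rightarrow> ereal) \<Rightarrow> bool" where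
  "complete_wrt F v \<longleftrightarrow>
     (\<forall>a :: nat \<Rightarrow> 'a. (\<forall>n. a n \<in> F) \<longrightarrow>
        (\<forall>N::nat. \<exists>n0. \<forall>m\<ge>n0. \<forall>n\<ge>n0. ereal (real N) \<le> v (a m - a n)) \<longrightarrow>
        (\<exists>l\<in>F. \<forall>N::nat. \<exists>n0. \<forall>n\<ge>n0. ereal (real N) \<le> v (a n - l)))"

definition complete_discretely_valued_field :: "'a::field set \<Rightarrow> ('a \<Rightarrow> ereal) \<Rightarrow> bool" where
  "complete_discretely_valued_field F v \<longleftrightarrow>
     subfield F amb \<and> normalized_valuation F v \<and> complete_wrt F v"

definition integer_ring :: "'a::field set \<Rightarrow> ('a \<Rightarrow> ereal) \<Rightarrow> 'a ring" where
  "integer_ring F v = amb\<lparr>carrier := valuation_ring F v\<rparr>"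

definition residue_field :: "'a::field set \<Rightarrow> ('a \<Rightarrow> ereal) \<Rightarrow> 'a set ring" where
  "residue_field F v = integer_ring F v Quot prime_power_ideal F v 1"

definition residue_class :: "'a::field set \<Rightarrow> ('a \<Rightarrow> ereal) \<Rightarrow> 'a \<Rightarrow> 'a set" where
  "residue_class F v a = prime_power_ideal F v 1 +>\<^bsub>integer_ring F v\<^esub> a"

definition residue_char :: "'a::field set \<Rightarrow> ('a \<Rightarrow> ereal) \<Rightarrow> nat \<Rightarrow> bool" where
  "residue_char F v p \<longleftrightarrow>
     (\<forall>n::nat. [n] \<cdot>\<^bsub>residue_field F v\<^esub> \<one>\<^bsub>residue_field F v\<^esub> = \<zero>\<^bsub>residue_field F v\<^esub> \<longleftrightarrow> p dvd n)"

definition unit_powers :: "('a, 'b) ring_scheme \<Rightarrow> nat \<Rightarrow> 'a set" where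
  "unit_powers R f = (\<lambda>u. u [^]\<^bsub>units_of R\<^esub> f) ` Units R"

text \<open>The order of the image of \<open>a\<close> in \<open>\<kappa>\<^sup>\<times>/(\<kappa>\<^sup>\<times>)\<^sup>f\<close>, where \<open>\<kappa>\<close> is the residue field of \<open>F\<close>.\<close>

definition residue_coset_order :: "'a::field set \<Rightarrow> ('a \<Rightarrow> ereal) \<Rightarrow> nat \<Rightarrow> 'a \<Rightarrow> nat" where
  "residue_coset_order F v f a =
     (let U = units_of (residue_field F v); H = unit_powers (residue_field F v) f
      in group.ord (U Mod H) (H #>\<^bsub>U\<^esub> residue_class F v a))"

text \<open>For complete \<open>K\<close> and finite \<open>F/K\<close>, the normalized valuation of \<open>F\<close> is the unique
  normalized valuation lying over that of \<open>K\<close>.\<close>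

definition lies_over_with_index ::
    "'a::field set \<Rightarrow> ('a \<Rightarrow> ereal) \<Rightarrow> ('a \<Rightarrow> ereal) \<Rightarrow> nat \<Rightarrow> bool" where
  "lies_over_with_index K vK vF e \<longleftrightarrow> 0 < e \<and> (\<forall>a\<in>K - {0}. vF a = ereal (real e) * vK a)"

definition valuation_of_extension ::
    "'a::field set \<Rightarrow> ('a \<Rightarrow> ereal) \<Rightarrow> 'a set \<Rightarrow> ('a \<Rightarrow> ereal) \<Rightarrow> bool" where
  "valuation_of_extension K vK F vF \<longleftrightarrow>
     normalized_valuation F vF \<and> (\<exists>e. lies_over_with_index K vK vF e)"

text \<open>Residue fields are finite here, so being ramified just means index greater than one.\<close>

definition typical_extension ::
    "nat \<Rightarrow> 'a::field set \<Rightarrow> ('a \<Rightarrow> ereal) \<Rightarrow> 'a set \<Rightarrow> ('a \<Rightarrow> ereal) \<Rightarrow> bool" where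
  "typical_extension p K vK L vL \<longleftrightarrow>
     subfield L amb \<and> K \<subseteq> L \<and> ring.dimension amb p K L \<and>
     (\<exists>e>1. lies_over_with_index K vK vL e) \<and>
     \<not> (\<exists>z\<in>L. prime_element K vK (z ^ p) \<and> L = adjoin K {z})"


section \<open>Galois groups and ramification\<close>

definition galois_group :: "'a::field set \<Rightarrow> 'a set \<Rightarrow> ('a \<Rightarrow> 'a) monoid" where
  "galois_group K N = BijGroup N
     \<lparr>carrier := {\<sigma> \<in> Bij N. \<sigma> \<in> ring_hom (amb\<lparr>carrier := N\<rparr>) (amb\<lparr>carrier := N\<rparr>) \<and> (\<forall>a\<in>K. \<sigma> a = a)}\<rparr>"

definition galois_extension :: "'a::field set \<Rightarrow> 'a set \<Rightarrow> bool" where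
  "galois_extension K N \<longleftrightarrow>
     subfield K amb \<and> subfield N amb \<and> K \<subseteq> N \<and> ring.finite_dimension amb K N \<and>
     {a \<in> N. \<forall>\<sigma> \<in> carrier (galois_group K N). \<sigma> a = a} = K"

definition galois_closure :: "'a::field set \<Rightarrow> 'a set \<Rightarrow> 'a set \<Rightarrow> bool" where
  "galois_closure K L M \<longleftrightarrow>
     galois_extension K M \<and> subfield L amb \<and> L \<subseteq> M \<and>
     (\<forall>N. galois_extension K N \<and> L \<subseteq> N \<and> N \<subseteq> M \<longrightarrow> N = M)"

text \<open>Serre, Local Fields, Chapter IV.  The real-indexed group below is \<open>G\<^sub>u = G\<^bsub>\<lceil>u\<rceil>\<^esub>\<close>,
  since \<open>v\<close> is integer valued.\<close>

definition lower_group :: "'a::field set \<Rightarrow> 'a set \<Rightarrow> ('a \<Rightarrow> ereal) \<Rightarrow> real \<Rightarrow> ('a \<Rightarrow> 'a) set" where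
  "lower_group K M v u =
     {\<sigma> \<in> carrier (galois_group K M). \<forall>a \<in> valuation_ring M v. ereal (u + 1) \<le> v (\<sigma> a - a)}"

definition herbrand_phi :: "'a::field set \<Rightarrow> 'a set \<Rightarrow> ('a \<Rightarrow> ereal) \<Rightarrow> real \<Rightarrow> real" where
  "herbrand_phi K M v u =
     (if u < 0 then u
      else integral {0..u} (\<lambda>t. real (card (lower_group K M v t)) / real (card (lower_group K M v 0))))"

definition upper_group :: "'a::field set \<Rightarrow> 'a set \<Rightarrow> ('a \<Rightarrow> ereal) \<Rightarrow> real \<Rightarrow> ('a \<Rightarrow> 'a) set" where
  "upper_group K M v w = lower_group K M v (THE u. -1 \<le> u \<and> herbrand_phi K M v u = w)"

definition upper_break :: "'a::field set \<Rightarrow> 'a set \<Rightarrow> ('a \<Rightarrow> ereal) \<Rightarrow> real \<Rightarrow> bool" where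
  "upper_break K M v w \<longleftrightarrow>
     -1 \<le> w \<and> (\<forall>\<epsilon>>0. upper_group K M v w \<noteq> upper_group K M v (w + \<epsilon>))"

text \<open>Here \<open>M\<close> is the Galois closure of the extension of \<open>K\<close> in question and \<open>v\<close> its valuation.\<close>

definition ramification_number :: "'a::field set \<Rightarrow> 'a set \<Rightarrow> ('a \<Rightarrow> ereal) \<Rightarrow> real \<Rightarrow> bool" where
  "ramification_number K M v l \<longleftrightarrow>
     upper_break K M v l \<and> (\<forall>w. upper_break K M v w \<longrightarrow> w \<le> l)"


section \<open>Teichmueller representatives\<close>

text \<open>If \<open>K\<close> has characteristic zero, then \<open>\<int>\<^sub>p \<subseteq> K\<close> is the closure of \<open>\<int>\<close>.\<close>

definition padic_integers_in :: "'a::field set \<Rightarrow> ('a \<Rightarrow> ereal) \<Rightarrow> 'a set" where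
  "padic_integers_in K v = {a \<in> K. \<forall>N::nat. \<exists>z::int. ereal (real N) \<le> v (a - of_int z)}"

definition primitive_unity_root :: "nat \<Rightarrow> 'a::field \<Rightarrow> bool" where
  "primitive_unity_root n a \<longleftrightarrow> 0 < n \<and> a ^ n = 1 \<and> (\<forall>k. 0 < k \<and> k < n \<longrightarrow> a ^ k \<noteq> 1)"

definition teichmueller_rep ::
    "nat \<Rightarrow> 'a::field set \<Rightarrow> ('a \<Rightarrow> ereal) \<Rightarrow> nat \<Rightarrow> 'a \<Rightarrow> bool" where
  "teichmueller_rep p K v r \<rho> \<longleftrightarrow>
     \<rho> \<in> padic_integers_in K v \<and> primitive_unity_root (p - 1) \<rho> \<and>
     (\<exists>c \<in> padic_integers_in K v. \<rho> - of_nat r = of_nat p * c)"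


section \<open>The group ring and its action\<close>

text \<open>An element of \<open>M[\<langle>\<sigma>\<rangle>]\<close>, for \<open>M\<close> the whole type, is a finitely supported function from
  automorphisms to coefficients.\<close>

definition group_ring_act :: "(('a::field \<Rightarrow> 'a) \<Rightarrow>\<^sub>0 'a) \<Rightarrow> 'a \<Rightarrow> 'a" where
  "group_ring_act \<xi> a = (\<Sum>\<tau> \<in> Poly_Mapping.keys \<xi>. Poly_Mapping.lookup \<xi> \<tau> * \<tau> a)"

definition Psi :: "nat \<Rightarrow> ('a::field \<Rightarrow> 'a) \<Rightarrow> 'a \<Rightarrow> 'a \<Rightarrow> nat \<Rightarrow> (('a \<Rightarrow> 'a) \<Rightarrow>\<^sub>0 'a)" where
  "Psi p \<sigma> y \<rho> r =
     Poly_Mapping.map (\<lambda>c. - (1 / y) * c)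
       (\<Sum>k = 0..p - 2. Poly_Mapping.single (\<sigma> ^^ (r ^ k)) (\<rho> powi (- int k)))"

end

theory Submission
  imports Defs
begin

text \<open>
  Put \<open>\<Psi> a = - (1/y) (\<Sum>\<^sub>k \<rho>\<^sub>0\<^bsup>-k\<^esup> \<sigma>\<^sup>r (a))\<close> with \<open>r = r\<^sub>0\<^sup>k\<close>. Since \<open>\<sigma>\<close> fixes \<open>y\<close> and
  \<open>\<sigma>\<close> preserves the valuation, \<open>\<sigma>\<^sup>r x \<equiv> x + \<rho>\<^sub>0\<^sup>k y\<close> modulo \<open>y \<Delta>\<close>; expanding \<open>(\<sigma>\<^sup>r x)\<^sup>i\<close> binomially, the sum
  over \<open>k\<close> kills every power \<open>y\<^sup>m\<close> with \<open>m \<noteq> 1\<close>, and \<open>v(y) > v(x)\<close> bounds the error.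
  In characteristic \<open>p\<close> the error bound is \<open>0\<close>, so both characteristics are treated at once.

  For \<open>\<Psi> x\<^sup>i \<in> L\<close>, every \<open>\<tau> \<in> Gal(M/L)\<close> satisfies \<open>\<tau> y = \<rho>\<^sub>0\<^sup>a y\<close> for some \<open>a\<close>, and \<open>\<tau> \<sigma> \<tau>\<^bsup>-1\<^esup>\<close> is a power
  of \<open>\<sigma>\<close>. Comparing the images of \<open>x\<close> in the residue field shows that the exponent is \<open>r\<^sub>0\<^sup>a\<close>, whence
  \<open>\<tau>\<close> commutes with \<open>\<Psi>\<close>. The comparison needs \<open>v(\<tau> \<Delta>) > 0\<close>, that is, the uniqueness of the extension
  of the valuation of the complete field \<open>K\<close>.

  The exponent in the congruence refers to \<open>v\<^sub>L\<close>, while \<open>\<Delta>\<close> is controlled by \<open>v\<^sub>M\<close>; the transition uses that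
  the ramification index of \<open>M/L\<close> is at least \<open>e\<close>, because \<open>v(y)\<close> has denominator \<open>e\<close> over \<open>K\<close> and the
  index of \<open>L/K\<close> divides \<open>p\<close>.
\<close>

section \<open>Subfields and automorphisms of the ambient field\<close>

lemma amb_simps [simp]:
  "carrier amb = UNIV" "\<one>\<^bsub>amb\<^esub> = 1" "\<zero>\<^bsub>amb\<^esub> = 0"
  "a \<otimes>\<^bsub>amb\<^esub> b = a * b" "a \<oplus>\<^bsub>amb\<^esub> b = a + b"
  by (simp_all add: ring_of_type_algebra_def)

lemma amb_minus [simp]: "\<ominus>\<^bsub>amb\<^esub> a = - (a :: 'a::field)"
proof -
  interpret R: cring "amb :: 'a ring" by (rule cring_from_type_algebra)
  show ?thesis by (rule R.minus_equality) auto
qed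

lemma amb_inv [simp]: "a \<noteq> 0 \<Longrightarrow> inv\<^bsub>amb\<^esub> a = inverse (a :: 'a::field)"
proof -
  interpret R: cring "amb :: 'a ring" by (rule cring_from_type_algebra)
  show "a \<noteq> 0 \<Longrightarrow> inv\<^bsub>amb\<^esub> a = inverse a" by (rule R.comm_inv_char) auto
qed

locale subfield_set =
  fixes K :: "'a::field set"
  assumes zero_mem [simp]: "0 \<in> K"
    and one_mem [simp]: "1 \<in> K"
    and add_mem: "a \<in> K \<Longrightarrow> b \<in> K \<Longrightarrow> a + b \<in> K"
    and minus_mem: "a \<in> K \<Longrightarrow> - a \<in> K"
    and mult_mem: "a \<in> K \<Longrightarrow> b \<in> K \<Longrightarrow> a * b \<in> K"
    and inverse_mem: "a \<in> K \<Longrightarrow> inverse a \<in> K"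
begin

lemma diff_mem: "a \<in> K \<Longrightarrow> b \<in> K \<Longrightarrow> a - b \<in> K"
  using add_mem[of a "- b"] minus_mem by simp

lemma divide_mem: "a \<in> K \<Longrightarrow> b \<in> K \<Longrightarrow> a / b \<in> K"
  by (simp add: divide_inverse inverse_mem mult_mem)

lemma power_mem: "a \<in> K \<Longrightarrow> a ^ n \<in> K"
  by (induction n) (auto intro: mult_mem)

lemma of_nat_mem [simp]: "of_nat n \<in> K"
  by (induction n) (auto intro: add_mem)

lemma of_int_mem [simp]: "of_int n \<in> K"
  by (cases n) (auto intro!: minus_mem simp del: of_nat_Suc)

lemma sum_mem: "(\<And>i. i \<in> A \<Longrightarrow> g i \<in> K) \<Longrightarrow> sum g A \<in> K"
  by (induction A rule: infinite_finite_induct) (auto intro: add_mem)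

end

lemma subfield_set_of_subfield:
  fixes K :: "'a::field set"
  assumes "subfield K amb"
  shows "subfield_set K"
proof -
  interpret R: field "amb :: 'a ring" by (rule field_from_type_algebra)
  have K: "subring K amb" by (rule subfieldE(1)[OF assms])
  show ?thesis
  proof
    fix a assume a: "a \<in> K"
    show "inverse a \<in> K"
    proof (cases "a = 0")
      case False
      then show ?thesis using R.subfield_m_inv(1)[OF assms, of a] a by simp
    qed (use a in simp)
  qed (use subringE[OF K] in auto)
qed

lemma subfield_set_Inter:
  assumes "\<And>F. F \<in> A \<Longrightarrow> subfield_set F"
  shows "subfield_set (\<Inter> A)"
  by unfold_locales
    (use assms in \<open>auto intro: subfield_set.zero_mem subfield_set.one_mem subfield_set.add_mem
      subfield_set.minus_mem subfield_set.mult_mem subfield_set.inverse_mem\<close>)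

lemma subfield_set_adjoin: "subfield_set (adjoin K S)"
proof
  fix a assume a: "a \<in> adjoin K S"
  show "inverse a \<in> adjoin K S"
    using a generate_field.m_inv[of a amb "K \<union> S"] unfolding adjoin_def by (cases "a = 0") auto
  show "- a \<in> adjoin K S"
    using a generate_field.a_inv[of a amb "K \<union> S"] unfolding adjoin_def by simp
  fix b assume b: "b \<in> adjoin K S"
  show "a + b \<in> adjoin K S" "a * b \<in> adjoin K S"
    using a b generate_field.eng_add[of a amb "K \<union> S" b] generate_field.eng_mult[of a amb "K \<union> S" b]
    unfolding adjoin_def by simp_all
next
  show "1 \<in> adjoin K S"
    using generate_field.one[of amb "K \<union> S"] by (simp add: adjoin_def)
  \<comment> \<open>\<open>generate_field\<close> has no introduction rule for zero, so zero is
    reached as \<open>1 + - 1\<close>.\<close>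
  then have "1 + - 1 \<in> adjoin K S"
    using generate_field.a_inv[of 1 amb "K \<union> S"] generate_field.eng_add[of 1 amb "K \<union> S" "- 1"]
    by (simp add: adjoin_def)
  then show "0 \<in> adjoin K S" by simp
qed

lemma adjoin_superset: "K \<union> S \<subseteq> adjoin K S"
  by (auto simp: adjoin_def intro: generate_field.incl)

lemma adjoin_least:
  assumes "subfield_set F" "K \<union> S \<subseteq> F"
  shows "adjoin K S \<subseteq> F"
proof
  interpret subfield_set F by fact
  fix a assume "a \<in> adjoin K S"
  then show "a \<in> F" unfolding adjoin_def
    by induction (use assms(2) in \<open>auto intro: add_mem mult_mem minus_mem inverse_mem\<close>)
qed

text \<open>The carrier of \<open>galois_group K UNIV\<close> at type level: \<open>M\<close> is the
  whole type, so the extensionality demanded by \<open>Bij\<close> is vacuous.\<close>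

definition field_automorphism :: "'a::field set \<Rightarrow> ('a \<Rightarrow> 'a) \<Rightarrow> bool" where
  "field_automorphism K \<tau> \<longleftrightarrow> bij \<tau> \<and> \<tau> 1 = 1 \<and> (\<forall>a\<in>K. \<tau> a = a) \<and>
     (\<forall>a b. \<tau> (a + b) = \<tau> a + \<tau> b) \<and> (\<forall>a b. \<tau> (a * b) = \<tau> a * \<tau> b)"

lemma carrier_galois_group_UNIV:
  "carrier (galois_group K (UNIV :: 'a::field set)) = {\<tau>. field_automorphism K \<tau>}"
  by (auto simp: galois_group_def field_automorphism_def Bij_def ring_hom_def)

lemma mult_galois_group_UNIV:
  "\<lbrakk>\<tau> \<in> carrier (galois_group K (UNIV :: 'a::field set)); \<tau>' \<in> carrier (galois_group K UNIV)\<rbrakk>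
     \<Longrightarrow> \<tau> \<otimes>\<^bsub>galois_group K UNIV\<^esub> \<tau>' = \<tau> \<circ> \<tau>'"
  by (auto simp: galois_group_def BijGroup_def compose_def)

lemma one_galois_group_UNIV: "\<one>\<^bsub>galois_group K (UNIV :: 'a::field set)\<^esub> = id"
  by (auto simp: galois_group_def BijGroup_def)

locale automorphism =
  fixes K :: "'a::field set" and \<tau> :: "'a \<Rightarrow> 'a"
  assumes field_automorphism: "field_automorphism K \<tau>"
begin

lemma bij: "bij \<tau>" and one [simp]: "\<tau> 1 = 1" and fixed: "a \<in> K \<Longrightarrow> \<tau> a = a"
  and add [simp]: "\<tau> (a + b) = \<tau> a + \<tau> b" and mult [simp]: "\<tau> (a * b) = \<tau> a * \<tau> b"
  using field_automorphism by (auto simp: field_automorphism_def)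

lemma inj_iff [simp]: "\<tau> a = \<tau> b \<longleftrightarrow> a = b"
  using bij by (simp add: bij_is_inj inj_eq)

lemma zero [simp]: "\<tau> 0 = 0"
proof -
  have "\<tau> 0 = \<tau> 0 + \<tau> 0"
    using add[of 0 0] by (simp only: add_0_left)
  then show ?thesis by (metis add_cancel_left_right)
qed

lemma eq_0_iff [simp]: "\<tau> a = 0 \<longleftrightarrow> a = 0"
  using inj_iff[of a 0] by (simp del: inj_iff)

lemma minus [simp]: "\<tau> (- a) = - \<tau> a"
  using add[of a "- a"] by (simp add: eq_neg_iff_add_eq_0 add.commute del: add)

lemma diff [simp]: "\<tau> (a - b) = \<tau> a - \<tau> b"
  using add[of a "- b"] by (simp del: add)

lemma inverse [simp]: "\<tau> (inverse a) = inverse (\<tau> a)"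
proof (cases "a = 0")
  case False
  then have "\<tau> a * \<tau> (inverse a) = 1"
    by (simp flip: mult)
  then show ?thesis by (metis inverse_unique)
qed simp

lemma divide [simp]: "\<tau> (a / b) = \<tau> a / \<tau> b"
  by (simp add: divide_inverse)

lemma power [simp]: "\<tau> (a ^ n) = \<tau> a ^ n"
  by (induction n) auto

lemma sum: "\<tau> (sum g A) = (\<Sum>i\<in>A. \<tau> (g i))"
  by (induction A rule: infinite_finite_induct) auto

lemma of_nat [simp]: "\<tau> (of_nat n) = of_nat n"
  by (induction n) auto

lemma subfield_set_fixed: "subfield_set {a. \<tau> a = a}"
  by unfold_locales auto

end

lemma field_automorphism_id: "field_automorphism K id"
  by (auto simp: field_automorphism_def)

lemma field_automorphism_comp:
  "field_automorphism K \<tau> \<Longrightarrow> field_automorphism K \<tau>' \<Longrightarrow> field_automorphism K (\<tau> \<circ> \<tau>')"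
  by (auto simp: field_automorphism_def intro: bij_comp)

lemma field_automorphism_inv:
  assumes "field_automorphism K \<tau>"
  shows "field_automorphism K (inv_into UNIV \<tau>)"
proof -
  interpret automorphism K \<tau> by (rule automorphism.intro) fact
  have inv: "\<tau> (inv_into UNIV \<tau> a) = a" "inv_into UNIV \<tau> (\<tau> a) = a" for a
    using bij by (simp_all add: bij_is_inj bij_is_surj surj_f_inv_f)
  show ?thesis
    unfolding field_automorphism_def
    using bij by (auto simp: bij_imp_bij_inv) (metis inv inj_iff one fixed add mult)+
qed

lemma field_automorphism_funpow: "field_automorphism K \<tau> \<Longrightarrow> field_automorphism K (\<tau> ^^ n)"
  by (induction n) (auto intro: field_automorphism_comp field_automorphism_id)

lemma group_galois_group_UNIV: "group (galois_group K (UNIV :: 'a::field set))"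
proof (rule groupI)
  let ?G = "galois_group K (UNIV :: 'a set)"
  have one: "\<one>\<^bsub>?G\<^esub> \<in> carrier ?G"
    by (simp add: one_galois_group_UNIV carrier_galois_group_UNIV field_automorphism_id)
  then show "\<one>\<^bsub>?G\<^esub> \<in> carrier ?G" .
  fix \<tau> assume \<tau>: "\<tau> \<in> carrier ?G"
  show "\<one>\<^bsub>?G\<^esub> \<otimes>\<^bsub>?G\<^esub> \<tau> = \<tau>"
    using one \<tau> by (simp add: mult_galois_group_UNIV) (simp add: one_galois_group_UNIV)
  show "\<exists>\<tau>'\<in>carrier ?G. \<tau>' \<otimes>\<^bsub>?G\<^esub> \<tau> = \<one>\<^bsub>?G\<^esub>"
  proof
    show "inv_into UNIV \<tau> \<in> carrier ?G"
      using \<tau> by (simp add: carrier_galois_group_UNIV field_automorphism_inv)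
    then show "inv_into UNIV \<tau> \<otimes>\<^bsub>?G\<^esub> \<tau> = \<one>\<^bsub>?G\<^esub>"
      using \<tau> by (simp add: mult_galois_group_UNIV one_galois_group_UNIV)
        (simp add: carrier_galois_group_UNIV field_automorphism_def bij_is_inj)
  qed
  fix \<tau>' assume \<tau>': "\<tau>' \<in> carrier ?G"
  show cl: "\<tau> \<otimes>\<^bsub>?G\<^esub> \<tau>' \<in> carrier ?G"
    using \<tau> \<tau>' by (simp add: mult_galois_group_UNIV)
      (simp add: carrier_galois_group_UNIV field_automorphism_comp)
  fix \<tau>'' assume \<tau>'': "\<tau>'' \<in> carrier ?G"
  have "\<tau>' \<otimes>\<^bsub>?G\<^esub> \<tau>'' \<in> carrier ?G"
    using \<tau>' \<tau>'' by (simp add: mult_galois_group_UNIV)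
      (simp add: carrier_galois_group_UNIV field_automorphism_comp)
  with cl show "\<tau> \<otimes>\<^bsub>?G\<^esub> \<tau>' \<otimes>\<^bsub>?G\<^esub> \<tau>'' = \<tau> \<otimes>\<^bsub>?G\<^esub> (\<tau>' \<otimes>\<^bsub>?G\<^esub> \<tau>'')"
    using \<tau> \<tau>' \<tau>'' by (simp add: mult_galois_group_UNIV o_assoc)
qed

text \<open>Powers in the Galois group are iterates of functions. This converts the hypothesis on
  the order of \<sigma> into the form used in the later locale.\<close>

lemma funpow_eq_id_iff_ord_dvd:
  assumes "field_automorphism K (\<sigma> :: 'a::field \<Rightarrow> 'a)"
  shows "\<sigma> ^^ n = id \<longleftrightarrow> group.ord (galois_group K UNIV) \<sigma> dvd n"
proof -
  interpret G: group "galois_group K (UNIV :: 'a set)" by (rule group_galois_group_UNIV)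
  have \<sigma>: "\<sigma> \<in> carrier (galois_group K UNIV)"
    using assms by (simp add: carrier_galois_group_UNIV)
  have "\<sigma> [^]\<^bsub>galois_group K UNIV\<^esub> n = \<sigma> ^^ n" for n :: nat
  proof (induction n)
    case (Suc n)
    have "\<sigma> [^]\<^bsub>galois_group K UNIV\<^esub> n \<in> carrier (galois_group K UNIV)"
      using \<sigma> by simp
    with Suc show ?case
      using \<sigma> by (simp add: mult_galois_group_UNIV funpow_swap1 fun_eq_iff)
  qed (simp add: one_galois_group_UNIV)
  then show ?thesis
    using G.pow_eq_id[OF \<sigma>, of n] by (simp add: one_galois_group_UNIV)
qed

section \<open>Absolute values\<close>

locale nonarch_abs =
  fixes N :: "'a::field \<Rightarrow> real"
  assumes N_eq_0_iff [simp]: "N a = 0 \<longleftrightarrow> a = 0"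
    and N_nonneg [simp]: "0 \<le> N a"
    and N_mult: "N (a * b) = N a * N b"
    and N_add: "N (a + b) \<le> max (N a) (N b)"
begin

lemma N_0 [simp]: "N 0 = 0"
  by simp

lemma N_pos: "a \<noteq> 0 \<Longrightarrow> 0 < N a"
  by (simp add: order_less_le)

lemma N_1 [simp]: "N 1 = 1"
  using N_mult[of 1 1] N_eq_0_iff[of 1] by (simp del: N_eq_0_iff)

lemma N_power: "N (a ^ n) = N a ^ n"
  by (induction n) (simp_all add: N_mult)

lemma N_minus [simp]: "N (- a) = N a"
proof -
  have "N (- 1) ^ 2 = 1"
    by (simp flip: N_power)
  then have "N (- 1) = 1"
    using N_nonneg[of "- 1"] by (simp add: power2_eq_1_iff del: N_nonneg)
  then show ?thesis
    using N_mult[of "- 1" a] by simp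
qed

lemma N_diff: "N (a - b) \<le> max (N a) (N b)"
  using N_add[of a "- b"] by simp

lemma N_inverse: "N (inverse a) = inverse (N a)"
proof (cases "a = 0")
  case False
  then have "N a * N (inverse a) = 1"
    by (simp flip: N_mult)
  then show ?thesis by (metis inverse_unique)
qed simp

lemma N_divide: "N (a / b) = N a / N b"
  by (simp add: divide_inverse N_mult N_inverse)

lemma N_add_le: "N a \<le> B \<Longrightarrow> N b \<le> B \<Longrightarrow> N (a + b) \<le> B"
  using N_add[of a b] by linarith

lemma N_diff_le: "N a \<le> B \<Longrightarrow> N b \<le> B \<Longrightarrow> N (a - b) \<le> B"
  using N_diff[of a b] by linarith

lemma N_sum_le: "0 \<le> B \<Longrightarrow> (\<And>i. i \<in> A \<Longrightarrow> N (g i) \<le> B) \<Longrightarrow> N (sum g A) \<le> B"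
  by (induction A rule: infinite_finite_induct) (auto intro: N_add_le)

lemma N_of_nat [simp]: "N (of_nat n) \<le> 1"
  by (induction n) (auto intro: N_add_le)

lemma N_of_int [simp]: "N (of_int n) \<le> 1"
  by (cases n) (simp_all del: of_nat_Suc)

lemma N_add_eq_max:
  assumes "N a \<noteq> N b"
  shows "N (a + b) = max (N a) (N b)"
proof -
  have "N b < N a \<Longrightarrow> N (a + b) = N a" for a b
    using N_add[of a b] N_diff[of "a + b" b] by auto
  from this[of a b] this[of b a] assms show ?thesis
    by (auto simp: add.commute max_def)
qed

text \<open>\<open>a ^ n - b ^ n\<close> is \<open>a - b\<close> times a sum of monomials in
  \<open>a\<close> and \<open>b\<close>, each of absolute value at most 1.\<close>

lemma N_power_diff_le:
  assumes "N a \<le> 1" "N b \<le> 1"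
  shows "N (a ^ n - b ^ n) \<le> N (a - b)"
proof -
  have "N (b ^ (n - Suc i) * a ^ i) \<le> 1" for i
    using mult_mono[OF power_mono[OF assms(2), of "n - Suc i"] power_mono[OF assms(1), of i]]
    by (simp add: N_mult N_power)
  then have "N (\<Sum>i<n. b ^ (n - Suc i) * a ^ i) \<le> 1"
    by (intro N_sum_le) auto
  from mult_left_mono[OF this, of "N (a - b)"] show ?thesis
    by (simp add: power_diff_sumr2 N_mult)
qed

text \<open>If \<open>x\<close> were no larger than \<open>y\<close>, both terms on the left would
  be bounded by \<open>N y ^ p\<close>, too small for \<beta>. So \<open>y\<close> is smaller than
  \<open>x\<close>; then \<open>x ^ p\<close> strictly dominates the linear term and carries the
  absolute value of \<beta>.\<close>

lemma artin_schreier_root: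
  assumes x: "x ^ p - y ^ (p - 1) * x = \<beta>" and \<beta>: "N y ^ p < N \<beta>" and p: "1 < p"
  shows "N y < N x" "N \<beta> = N x ^ p"
proof -
  have p0: "0 < p" using p by simp
  show yx: "N y < N x"
  proof (rule ccontr)
    assume "\<not> N y < N x"
    then have "N x \<le> N y" by simp
    then have "N (x ^ p) \<le> N y ^ p" "N (y ^ (p - 1) * x) \<le> N y ^ (p - 1) * N y"
      by (auto simp: N_power N_mult intro: power_mono mult_left_mono)
    moreover have "N y ^ (p - 1) * N y = N y ^ p"
      using p0 by (metis power_minus_mult)
    ultimately have "N (x ^ p - y ^ (p - 1) * x) \<le> N y ^ p"
      by (intro N_diff_le) auto
    then show False using \<beta> x by simp
  qed
  have "N y ^ (p - 1) * N x < N x ^ (p - 1) * N x"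
    using yx p by (intro mult_strict_right_mono power_strict_mono) (auto intro: le_less_trans[OF N_nonneg])
  also have "\<dots> = N x ^ p"
    using p0 by (metis power_minus_mult)
  finally have less: "N (- (y ^ (p - 1) * x)) < N (x ^ p)"
    by (simp add: N_mult N_power)
  then show "N \<beta> = N x ^ p"
    using N_add_eq_max[of "x ^ p" "- (y ^ (p - 1) * x)"] x by (simp add: N_power)
qed

text \<open>Without ties among the absolute values of the nonzero terms nothing cancels. Serves for
  expansions in powers of \<open>x\<close> over \<open>K\<close>, where ramification excludes
  ties.\<close>

lemma N_sum_eq_summand:
  fixes n :: nat
  assumes "\<And>m m'. \<lbrakk>m < n; m' < n; m \<noteq> m'; g m \<noteq> 0; g m' \<noteq> 0\<rbrakk> \<Longrightarrow> N (g m) \<noteq> N (g m')"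
    and "(\<Sum>m<n. g m) \<noteq> 0"
  shows "\<exists>m<n. g m \<noteq> 0 \<and> N (\<Sum>m<n. g m) = N (g m)"
  using assms
proof (induction n)
  case (Suc n)
  let ?S = "\<Sum>m<n. g m"
  consider "?S = 0" | "g n = 0" | "?S \<noteq> 0" "g n \<noteq> 0" by blast
  then show ?case
  proof cases
    case 1
    then show ?thesis using Suc.prems by auto
  next
    case 2
    then show ?thesis using Suc by (auto simp: less_Suc_eq)
  next
    case 3
    then obtain m where m: "m < n" "g m \<noteq> 0" "N ?S = N (g m)"
      using Suc by (metis less_SucI)
    then have "N (?S + g n) = max (N (g m)) (N (g n))"
      using Suc.prems(1)[of m n] 3 N_add_eq_max[of ?S "g n"] by simp
    then have "N (?S + g n) = N (g m) \<or> N (?S + g n) = N (g n)"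
      by (simp add: max_def)
    then show ?thesis
      using m 3 by (metis lessI less_SucI sum.lessThan_Suc)
  qed
qed simp

text \<open>Recovers an exponent modulo \<open>p\<close> from its image in the residue field. By
  symmetry \<open>i \<le> j\<close> may be assumed, so that \<open>j - i\<close> is the true
  difference.\<close>

lemma cong_if_N_diff_less_1:
  assumes residue_char: "\<And>n. N (of_nat n) < 1 \<longleftrightarrow> p dvd n" and "N (of_nat i - of_nat j) < 1"
  shows "[i = j] (mod p)"
  using assms(2)
proof (induction i j rule: linorder_wlog)
  case (le i j)
  then have "N (of_nat (j - i)) < 1"
    using N_minus[of "of_nat i - of_nat j"] by (simp add: of_nat_diff)
  then have "p dvd j - i"
    by (simp add: residue_char)
  then show ?case
    using le(1) cong_altdef_nat[of i j p] by (simp add: cong_sym_eq)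
next
  case (sym i j)
  then show ?case
    using N_minus[of "of_nat i - of_nat j"] by (simp add: cong_sym_eq)
qed

end

text \<open>The completeness of \<open>K\<close> forces every \<open>K\<close>-linear map on a finite-dimensional space to be
  bounded; for automorphisms, taking powers improves the bound to invariance of the absolute value.\<close>

locale complete_subfield = nonarch_abs N + subfield_set K
  for N :: "'a::field \<Rightarrow> real" and K +
  assumes complete: "\<lbrakk>\<And>n. a n \<in> K; \<And>\<epsilon>. 0 < \<epsilon> \<Longrightarrow> \<exists>n0. \<forall>m\<ge>n0. \<forall>n\<ge>n0. N (a m - a n) < \<epsilon>\<rbrakk>
    \<Longrightarrow> \<exists>l\<in>K. (\<lambda>n. N (a n - l)) \<longlonglongrightarrow> 0"
begin

definition N_Cauchy :: "(nat \<Rightarrow> 'a) \<Rightarrow> bool" where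
  "N_Cauchy a \<longleftrightarrow> (\<forall>\<epsilon>>0. \<exists>n0. \<forall>m\<ge>n0. \<forall>n\<ge>n0. N (a m - a n) < \<epsilon>)"

definition N_complete :: "'a set \<Rightarrow> bool" where
  "N_complete W \<longleftrightarrow>
     (\<forall>a. range a \<subseteq> W \<longrightarrow> N_Cauchy a \<longrightarrow> (\<exists>l\<in>W. (\<lambda>n. N (a n - l)) \<longlonglongrightarrow> 0))"

lemma N_limit_unique:
  assumes "(\<lambda>n. N (a n - l)) \<longlonglongrightarrow> 0" "(\<lambda>n. N (a n - l')) \<longlonglongrightarrow> 0"
  shows "l = l'"
proof -
  have "(\<lambda>n. max (N (a n - l')) (N (a n - l))) \<longlonglongrightarrow> max 0 0"
    by (intro tendsto_max assms)
  moreover have "N (l - l') \<le> max (N (a n - l')) (N (a n - l))" for n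
    using N_diff[of "a n - l'" "a n - l"] by simp
  ultimately have "N (l - l') \<le> max 0 0"
    by (intro LIMSEQ_le_const) auto
  then have "N (l - l') = 0"
    using N_nonneg[of "l - l'"] by linarith
  then show ?thesis by simp
qed

lemma N_Cauchy_if_le:
  assumes "N_Cauchy a" "0 < C" "\<And>m n. N (b m - b n) \<le> C * N (a m - a n)"
  shows "N_Cauchy b"
  unfolding N_Cauchy_def
proof (intro allI impI)
  fix \<epsilon> :: real assume "0 < \<epsilon>"
  then obtain n0 where n0: "\<forall>m\<ge>n0. \<forall>n\<ge>n0. N (a m - a n) < \<epsilon> / C"
    using assms(1,2) unfolding N_Cauchy_def by (meson divide_pos_pos)
  have "N (b m - b n) < \<epsilon>" if "m \<ge> n0" "n \<ge> n0" for m n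
  proof -
    have "C * N (a m - a n) < \<epsilon>"
      using n0 that assms(2) by (simp add: pos_less_divide_eq mult.commute)
    then show ?thesis using assms(3)[of m n] by linarith
  qed
  then show "\<exists>n0. \<forall>m\<ge>n0. \<forall>n\<ge>n0. N (b m - b n) < \<epsilon>" by blast
qed

lemma N_Cauchy_if_convergent:
  assumes "(\<lambda>n. N (a n - l)) \<longlonglongrightarrow> 0"
  shows "N_Cauchy a"
  unfolding N_Cauchy_def
proof (intro allI impI)
  fix \<epsilon> :: real assume "0 < \<epsilon>"
  then obtain n0 where n0: "\<forall>n\<ge>n0. N (a n - l) < \<epsilon>"
    using order_tendstoD(2)[OF assms] by (auto simp: eventually_sequentially)
  have "N (a m - a n) < \<epsilon>" if "m \<ge> n0" "n \<ge> n0" for m n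
    using N_diff[of "a m - l" "a n - l"] n0 that by (fastforce simp: max_def split: if_splits)
  then show "\<exists>n0. \<forall>m\<ge>n0. \<forall>n\<ge>n0. N (a m - a n) < \<epsilon>" by blast
qed

text \<open>Complete subspaces are closed: if \<open>v\<close> were approximated arbitrarily well
  from \<open>W\<close>, the approximants would form a Cauchy sequence with limit in
  \<open>W\<close>, and this limit would be \<open>v\<close>.\<close>

lemma N_complete_distance:
  assumes W: "N_complete W" "\<And>a b. a \<in> W \<Longrightarrow> b \<in> W \<Longrightarrow> a - b \<in> W" and v: "v \<notin> W"
  obtains \<delta> where "0 < \<delta>" "\<And>w. w \<in> W \<Longrightarrow> \<delta> \<le> N (v - w)"
proof (rule ccontr)
  assume "\<not> thesis"
  with that have "\<exists>w\<in>W. N (v - w) < \<delta>" if "0 < \<delta>" for \<delta>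
    using \<open>0 < \<delta>\<close> by (meson not_le)
  then have "\<exists>w\<in>W. N (v - w) < 1 / (Suc n)" for n
    by simp
  then obtain w where w: "\<And>n. w n \<in> W" "\<And>n. N (v - w n) < 1 / Suc n"
    by metis
  have N_w: "N (w n - v) < 1 / Suc n" for n
    using w(2)[of n] N_minus[of "w n - v"] by simp
  have lim: "(\<lambda>n. N (w n - v)) \<longlonglongrightarrow> 0"
    by (rule real_tendsto_sandwich[OF _ _ tendsto_const LIMSEQ_Suc[OF lim_1_over_n]])
      (use N_w in \<open>auto intro!: always_eventually less_imp_le\<close>)
  with W w(1) N_Cauchy_if_convergent obtain l where "l \<in> W" "(\<lambda>n. N (w n - l)) \<longlonglongrightarrow> 0"
    unfolding N_complete_def by blast
  with N_limit_unique[OF lim] v show False by auto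
qed

text \<open>Induction on the dimension, adding one vector \<open>v\<close> at a time. The positive
  distance from \<open>v\<close> to \<open>W\<close> bounds both components of
  \<open>k * v + w\<close>, so completeness and boundedness pass to the larger space. The induction
  rule takes the field as an argument, hence the separate premise \<open>K' = K\<close>.\<close>

lemma linear_bounded_aux:
  assumes dim: "ring.dimension amb n K' W" and K': "K' = K"
    and add: "\<And>a b. \<phi> (a + b) = \<phi> a + \<phi> b" and scale: "\<And>k a. k \<in> K \<Longrightarrow> \<phi> (k * a) = k * \<phi> a"
  shows "(\<forall>a\<in>W. \<forall>b\<in>W. a + b \<in> W) \<and> (\<forall>k\<in>K. \<forall>a\<in>W. k * a \<in> W) \<and>
    N_complete W \<and> (\<exists>C>0. \<forall>a\<in>W. N (\<phi> a) \<le> C * N a)"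
proof -
  interpret R: ring "amb :: 'a ring" by (rule ring_from_type_algebra)
  have \<phi>0: "\<phi> 0 = 0"
    using scale[of 0 0] by simp
  show ?thesis
    using dim K'
  proof (induction n K' W rule: R.dimension.induct)
    case (zero_dim K')
    have "N_complete {0}"
      by (auto simp: N_complete_def image_subset_iff)
    then show ?case
      using \<phi>0 by (auto intro!: exI[of _ 1])
  next
    case (Suc_dim v W n K')
    define W' where "W' = R.line_extension K' v W"
    have mem_W': "a \<in> W' \<longleftrightarrow> (\<exists>k\<in>K. \<exists>w\<in>W. a = k * v + w)" for a
      using Suc_dim.prems by (simp add: W'_def R.line_extension_mem_iff)
    from Suc_dim.IH[OF Suc_dim.prems] obtain C where W_add: "\<And>a b. a \<in> W \<Longrightarrow> b \<in> W \<Longrightarrow> a + b \<in> W"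
      and W_scale: "\<And>k a. k \<in> K \<Longrightarrow> a \<in> W \<Longrightarrow> k * a \<in> W"
      and W: "N_complete W" and C: "0 < C" "\<And>a. a \<in> W \<Longrightarrow> N (\<phi> a) \<le> C * N a"
      by blast
    have W_diff: "a - b \<in> W" if "a \<in> W" "b \<in> W" for a b
      using W_add[of a "- 1 * b"] W_scale[of "- 1" b] that minus_mem[OF one_mem] by simp
    obtain \<delta> where \<delta>: "0 < \<delta>" "\<And>w. w \<in> W \<Longrightarrow> \<delta> \<le> N (v - w)"
      using N_complete_distance[OF W W_diff] Suc_dim.hyps(2) by blast
    \<comment> \<open>With \<open>z = k * v + w\<close> one has \<open>w = z - k * v\<close> and
      \<open>N k \<le> N z / \<delta>\<close>; \<open>D\<close> is the resulting bound for
      \<open>N w\<close> relative to \<open>N z\<close>.\<close>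
    define D where "D = 1 + N v / \<delta>"
    have D: "0 < D"
      using \<delta>(1) by (simp add: D_def add_pos_nonneg)
    \<comment> \<open>For \<open>k \<noteq> 0\<close>, dividing by \<open>k\<close> turns
      \<open>k * v + w\<close> into \<open>v\<close> minus an element of \<open>W\<close>, which has
      absolute value at least \<delta>.\<close>
    have coeff: "N k \<le> N (k * v + w) / \<delta>" if "k \<in> K" "w \<in> W" for k w
    proof (cases "k = 0")
      case False
      have "- inverse k * w \<in> W"
        using that by (intro W_scale minus_mem inverse_mem)
      then have "\<delta> * N k \<le> N (v - (- inverse k * w)) * N k"
        by (intro mult_right_mono \<delta>(2)) auto
      also have "\<dots> = N ((v - (- inverse k * w)) * k)"
        by (simp only: N_mult)
      also have "(v - (- inverse k * w)) * k = k * v + w"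
        using False by (simp add: field_simps)
      finally show ?thesis
        using \<delta>(1) by (simp add: pos_le_divide_eq mult.commute)
    qed (use \<delta>(1) in simp)
    have rest: "N w \<le> D * N (k * v + w)" if kw: "k \<in> K" "w \<in> W" for k w
    proof -
      define z where "z = k * v + w"
      have "N k * N v \<le> N z / \<delta> * N v"
        unfolding z_def by (intro mult_right_mono coeff kw) simp
      moreover have "N w \<le> max (N z) (N k * N v)"
        using N_diff[of z "k * v"] by (simp add: z_def N_mult)
      moreover have "0 \<le> N z / \<delta> * N v"
        using \<delta>(1) by simp
      moreover have "D * N z = N z + N z / \<delta> * N v"
        by (simp add: D_def distrib_right)
      ultimately have "N w \<le> D * N z"
        using N_nonneg[of z] by linarith
      then show ?thesis by (simp add: z_def)
    qed
    have "a + b \<in> W'" if "a \<in> W'" "b \<in> W'" for a b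
    proof -
      from that obtain k w k' w' where "k \<in> K" "w \<in> W" "a = k * v + w" "k' \<in> K" "w' \<in> W" "b = k' * v + w'"
        unfolding mem_W' by blast
      then show ?thesis
        unfolding mem_W' by (intro bexI[of _ "k + k'"] bexI[of _ "w + w'"] add_mem W_add) (simp_all add: algebra_simps)
    qed
    moreover have "c * a \<in> W'" if "c \<in> K" "a \<in> W'" for c a
    proof -
      from that obtain k w where "k \<in> K" "w \<in> W" "a = k * v + w"
        unfolding mem_W' by blast
      then show ?thesis
        unfolding mem_W' using that
        by (intro bexI[of _ "c * k"] bexI[of _ "c * w"] mult_mem W_scale) (simp_all add: algebra_simps)
    qed
    moreover have "\<exists>C'>0. \<forall>a\<in>W'. N (\<phi> a) \<le> C' * N a"
    \<comment> \<open>The first summand bounds \<phi> on the multiple of \<open>v\<close>, the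
      second on the component in \<open>W\<close>.\<close>
    proof (intro exI[of _ "N (\<phi> v) / \<delta> + C * D"] conjI ballI)
      show "0 < N (\<phi> v) / \<delta> + C * D"
        using \<delta>(1) C(1) D by (simp add: add_nonneg_pos)
      fix a assume "a \<in> W'"
      then obtain k w where a: "k \<in> K" "w \<in> W" "a = k * v + w"
        unfolding mem_W' by blast
      have "N k * N (\<phi> v) \<le> N a / \<delta> * N (\<phi> v)"
        using coeff[OF a(1,2)] a(3) by (intro mult_right_mono) auto
      moreover have "N (\<phi> w) \<le> C * (D * N a)"
        using C rest[OF a(1,2)] a(2,3) by (meson mult_left_mono order_trans less_imp_le)
      moreover have "N (\<phi> a) \<le> max (N k * N (\<phi> v)) (N (\<phi> w))"
        using N_add[of "k * \<phi> v" "\<phi> w"] a by (simp add: add scale N_mult)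
      moreover have "0 \<le> N k * N (\<phi> v)" by simp
      moreover have "(N (\<phi> v) / \<delta> + C * D) * N a = N a / \<delta> * N (\<phi> v) + C * (D * N a)"
        by (simp add: distrib_right)
      ultimately show "N (\<phi> a) \<le> (N (\<phi> v) / \<delta> + C * D) * N a"
        using N_nonneg[of "\<phi> w"] by linarith
    qed
    moreover have "N_complete W'"
      unfolding N_complete_def
    proof (intro allI impI)
      fix a :: "nat \<Rightarrow> 'a" assume "range a \<subseteq> W'" and a: "N_Cauchy a"
      then have "\<forall>n. \<exists>k w. k \<in> K \<and> w \<in> W \<and> a n = k * v + w"
        using mem_W' by fast
      then obtain k w where kw: "\<And>n. k n \<in> K" "\<And>n. w n \<in> W" "\<And>n. a n = k n * v + w n"
        by metis
      have diff: "a m - a n = (k m - k n) * v + (w m - w n)" for m n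
        by (simp add: kw(3) algebra_simps)
      have "N_Cauchy k"
        using coeff[OF diff_mem[OF kw(1,1)] W_diff[OF kw(2,2)]] \<delta>(1)
        by (intro N_Cauchy_if_le[OF a, of "1 / \<delta>"]) (simp_all add: diff)
      then obtain k' where k': "k' \<in> K" "(\<lambda>n. N (k n - k')) \<longlonglongrightarrow> 0"
        using complete[of k] kw(1) unfolding N_Cauchy_def by blast
      have "N_Cauchy w"
        using rest[OF diff_mem[OF kw(1,1)] W_diff[OF kw(2,2)]] D
        by (intro N_Cauchy_if_le[OF a, of D]) (simp_all add: diff)
      then obtain w' where w': "w' \<in> W" "(\<lambda>n. N (w n - w')) \<longlonglongrightarrow> 0"
        using W kw(2) unfolding N_complete_def by blast
      have "(\<lambda>n. max (N (k n - k') * N v) (N (w n - w'))) \<longlonglongrightarrow> max (0 * N v) 0"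
        by (intro tendsto_max tendsto_mult k' w' tendsto_const)
      then have lim: "(\<lambda>n. max (N (k n - k') * N v) (N (w n - w'))) \<longlonglongrightarrow> 0"
        by simp
      have "N (a n - (k' * v + w')) \<le> max (N (k n - k') * N v) (N (w n - w'))" for n
      proof -
        have "a n - (k' * v + w') = (k n - k') * v + (w n - w')"
          by (simp add: kw(3) algebra_simps)
        then show ?thesis
          using N_add[of "(k n - k') * v" "w n - w'"] by (simp only: N_mult)
      qed
      then have "(\<lambda>n. N (a n - (k' * v + w'))) \<longlonglongrightarrow> 0"
        by (intro real_tendsto_sandwich[OF _ _ tendsto_const lim] always_eventually) auto
      then show "\<exists>l\<in>W'. (\<lambda>n. N (a n - l)) \<longlonglongrightarrow> 0"
        using k'(1) w'(1) mem_W' by blast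
    qed
    ultimately show ?case
      unfolding W'_def by blast
  qed
qed

lemma N_automorphism_le:
  assumes \<tau>: "field_automorphism K \<tau>" and fin: "ring.finite_dimension amb K UNIV"
  shows "N (\<tau> a) \<le> N a"
proof (rule ccontr)
  interpret automorphism K \<tau> by (rule automorphism.intro) fact
  interpret R: ring "amb :: 'a ring" by (rule ring_from_type_algebra)
  assume less: "\<not> N (\<tau> a) \<le> N a"
  then have a: "a \<noteq> 0" by auto
  obtain C where C: "\<And>a. N (\<tau> a) \<le> C * N a"
    using fin linear_bounded_aux[of _ K UNIV \<tau>] fixed unfolding R.finite_dimension_def
    by (simp add: fixed) blast
  define q where "q = N (\<tau> a) / N a"
  have "1 < q"
    using less N_pos[OF a] by (simp add: q_def)
  then obtain n where "C < q ^ n"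
    using real_arch_pow by blast
  moreover have "q ^ n \<le> C"
    using C[of "a ^ n"] N_pos[OF a] by (simp add: q_def N_power power_divide divide_simps)
  ultimately show False by simp
qed

lemma N_automorphism:
  assumes "field_automorphism K \<tau>" "ring.finite_dimension amb K UNIV"
  shows "N (\<tau> a) = N a"
proof (rule antisym)
  have "inv_into UNIV \<tau> (\<tau> a) = a"
    using assms(1) by (simp add: field_automorphism_def bij_is_inj)
  then show "N a \<le> N (\<tau> a)"
    using N_automorphism_le[OF field_automorphism_inv[OF assms(1)] assms(2), of "\<tau> a"] by simp
qed (rule N_automorphism_le[OF assms])

end

section \<open>Roots of unity\<close>

text \<open>Raising the shift by one trades \<open>g a\<close> for \<open>g (n + a)\<close>, which
  are equal by periodicity. This reindexing underlies the equivariance of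
  \<open>psi\<close>.\<close>

lemma sum_mod_shift:
  fixes g :: "nat \<Rightarrow> 'a::ab_group_add"
  assumes "\<And>k. g (k + n) = g k"
  shows "(\<Sum>k<n. g (k + a)) = (\<Sum>k<n. g k)"
proof (induction a)
  case (Suc a)
  have "(\<Sum>k<n. g (Suc k + a)) + g a = (\<Sum>k<n. g (k + a)) + g (n + a)"
    using sum.lessThan_Suc_shift[of "\<lambda>k. g (k + a)" n] sum.lessThan_Suc[of "\<lambda>k. g (k + a)" n]
    by (simp add: add.commute)
  with Suc assms[of a] show ?case by (simp add: add.commute)
qed simp

lemma primitive_unity_rootD:
  assumes "primitive_unity_root n \<rho>"
  shows "0 < n" "\<rho> ^ n = 1" "\<rho> \<noteq> 0" "\<And>k. \<rho> ^ (k + n) = \<rho> ^ k"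
    "\<And>k. 0 < k \<Longrightarrow> k < n \<Longrightarrow> \<rho> ^ k \<noteq> 1"
  using assms by (auto simp: primitive_unity_root_def power_add power_0_left split: if_splits)

text \<open>Counting: the powers of \<rho> already supply \<open>n\<close> distinct roots of a
  polynomial of degree at most \<open>n\<close>.\<close>

lemma unity_root_is_power:
  assumes \<rho>: "primitive_unity_root n (\<rho> :: 'a::field)" and z: "z ^ n = 1"
  shows "\<exists>k<n. z = \<rho> ^ k"
proof -
  note \<rho>' = primitive_unity_rootD[OF \<rho>]
  define q where "q = Polynomial.monom (1 :: 'a) n - 1"
  have "Polynomial.coeff q n = 1"
    using \<rho>'(1) by (simp add: q_def coeff_1)
  then have q0: "q \<noteq> 0" by auto
  have "Polynomial.degree q \<le> n"
    unfolding q_def by (intro degree_diff_le) (auto simp: degree_monom_le)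
  with card_poly_roots_bound[OF q0] have card: "card {z. poly q z = 0} \<le> n" by simp
  have roots: "{z. poly q z = 0} = {z. z ^ n = 1}"
    by (simp add: q_def poly_monom)
  have inj: "inj_on (\<lambda>k. \<rho> ^ k) {..<n}"
  proof (rule linorder_inj_onI)
    fix j k assume "j < k" "j \<in> {..<n}" "k \<in> {..<n}"
    then show "\<rho> ^ j \<noteq> \<rho> ^ k"
      using \<rho>'(3) \<rho>'(5)[of "k - j"] by (auto simp: power_diff less_imp_diff_less)
  qed auto
  have "(\<lambda>k. \<rho> ^ k) ` {..<n} = {z. z ^ n = 1}"
  proof (rule card_seteq)
    show "finite {z :: 'a. z ^ n = 1}"
      using poly_roots_finite[OF q0] roots by simp
    show "(\<lambda>k. \<rho> ^ k) ` {..<n} \<subseteq> {z. z ^ n = 1}"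
      using \<rho>'(2) by (auto simp flip: power_mult simp: mult.commute[of _ n]) (simp add: power_mult)
    show "card {z :: 'a. z ^ n = 1} \<le> card ((\<lambda>k. \<rho> ^ k) ` {..<n})"
      using card roots inj by (simp add: card_image)
  qed
  then show ?thesis using z by blast
qed

text \<open>A geometric sum with ratio \<open>q = \<rho> ^ (m - 1)\<close>, read as
  \<open>inverse \<rho>\<close> for \<open>m = 0\<close>. For \<open>m \<noteq> 1\<close> the ratio
  is an \<open>n\<close>-th root of unity other than 1; the case \<open>m = 0\<close> relies on
  \<open>1 < n\<close>.\<close>

lemma sum_inverse_powers_unity_root:
  assumes \<rho>: "primitive_unity_root n (\<rho> :: 'a::field)" and m: "m \<le> n" "1 < n"
  shows "(\<Sum>k<n. inverse \<rho> ^ k * \<rho> ^ (k * m)) = (if m = 1 then of_nat n else 0)"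
proof (cases "m = 1")
  case True
  then show ?thesis
    using primitive_unity_rootD(3)[OF \<rho>] by (simp flip: power_mult_distrib)
next
  case False
  note \<rho>' = primitive_unity_rootD[OF \<rho>]
  define q where "q = inverse \<rho> * \<rho> ^ m"
  have "q \<noteq> 1"
  proof
    assume "q = 1"
    then have eq: "\<rho> ^ m = \<rho>"
      using \<rho>'(3) by (simp add: q_def field_simps)
    show False
    proof (cases m)
      case 0
      then show False using eq \<rho>'(5)[of 1] m(2) by simp
    next
      case (Suc m')
      then show False using eq False m \<rho>'(3) \<rho>'(5)[of m'] by simp
    qed
  qed
  moreover have "q ^ n = 1"
    using \<rho>'(2) by (simp add: q_def power_mult_distrib power_inverse flip: power_mult)
      (simp add: mult.commute[of m] power_mult)
  moreover have "inverse \<rho> ^ k * \<rho> ^ (k * m) = q ^ k" for k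
    by (simp add: q_def power_mult_distrib power_inverse mult.commute[of k] power_mult)
  ultimately show ?thesis
    using False sum_gp_strict[of q n] by simp
qed

section \<open>The Galois action on an Artin--Schreier-like extension\<close>

text \<open>The Galois closure \<open>M\<close> is the whole type and \<open>L\<close> is
  \<open>adjoin K {x}\<close>. The coefficient of \<open>x\<close> is written as
  \<open>y ^ (p - 1)\<close>, and \<open>separable\<close> says that the derivative of the defining
  polynomial does not vanish at \<open>x\<close>.\<close>

locale artin_schreier_like = complete_subfield N K
  for N :: "'a::field \<Rightarrow> real" and K +
  fixes p :: nat and \<sigma> :: "'a \<Rightarrow> 'a" and x y \<Delta> \<beta> \<rho> :: 'a
  assumes p: "Factorial_Ring.prime p" "p \<noteq> 2"
    and \<sigma>: "field_automorphism K \<sigma>" "\<And>n. \<sigma> ^^ n = id \<longleftrightarrow> p dvd n"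
    and finite_dimension: "ring.finite_dimension amb K UNIV"
    and fixed_field: "\<And>a. (\<And>\<tau>. field_automorphism K \<tau> \<Longrightarrow> \<tau> a = a) \<Longrightarrow> a \<in> K"
    and generates: "adjoin K {x, y} = UNIV"
    and \<sigma>_y: "\<sigma> y = y" and \<sigma>_x: "\<sigma> x = x + y + y * \<Delta>"
    and y: "y \<noteq> 0" "y ^ (p - 1) \<in> K"
    and x: "x ^ p - y ^ (p - 1) * x = \<beta>" and \<beta>: "\<beta> \<in> K" "N y ^ p < N \<beta>"
    and separable: "of_nat p * x ^ (p - 1) \<noteq> y ^ (p - 1)"
    and \<rho>: "\<rho> \<in> K" "primitive_unity_root (p - 1) \<rho>"
begin

lemma p_gt_2: "2 < p"
  using p prime_ge_2_nat[of p] by linarith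

lemmas \<rho>_root = primitive_unity_rootD[OF \<rho>(2)]

sublocale \<sigma>: automorphism K \<sigma>
  by (rule automorphism.intro) (rule \<sigma>)

lemma \<sigma>_pow: "field_automorphism K (\<sigma> ^^ n)"
  by (rule field_automorphism_funpow[OF \<sigma>(1)])

lemma \<sigma>_pow_y [simp]: "(\<sigma> ^^ n) y = y"
  by (induction n) (auto simp: \<sigma>_y)

lemma N_\<sigma> [simp]: "N (\<sigma> a) = N a"
  by (rule N_automorphism[OF \<sigma>(1) finite_dimension])

lemma automorphism_eqI:
  assumes "field_automorphism K \<tau>" "field_automorphism K \<tau>'" "\<tau> x = \<tau>' x" "\<tau> y = \<tau>' y"
  shows "\<tau> = \<tau>'"
proof -
  interpret t: automorphism K \<tau> by (rule automorphism.intro) fact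
  interpret t': automorphism K \<tau>' by (rule automorphism.intro) fact
  have "subfield_set {a. \<tau> a = \<tau>' a}"
    by unfold_locales auto
  moreover have "K \<union> {x, y} \<subseteq> {a. \<tau> a = \<tau>' a}"
    using assms by (auto simp: t.fixed t'.fixed)
  ultimately have "UNIV \<subseteq> {a. \<tau> a = \<tau>' a}"
    unfolding generates[symmetric] by (rule adjoin_least)
  then show ?thesis by auto
qed

text \<open>An iterate of \<sigma> fixing \<open>x\<close> also fixes \<open>y\<close>, hence is the
  identity, and its exponent is divisible by \<open>p\<close>.\<close>

lemma \<sigma>_pow_x_inj: "inj_on (\<lambda>j. (\<sigma> ^^ j) x) {..<p}"
proof (rule linorder_inj_onI)
  fix j k assume jk: "j < k" "j \<in> {..<p}" "k \<in> {..<p}"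
  show "(\<sigma> ^^ j) x \<noteq> (\<sigma> ^^ k) x"
  proof
    assume "(\<sigma> ^^ j) x = (\<sigma> ^^ k) x"
    also have "\<sigma> ^^ k = \<sigma> ^^ j \<circ> \<sigma> ^^ (k - j)"
      using jk(1) by (simp flip: funpow_add)
    finally have "(\<sigma> ^^ (k - j)) x = x"
      using automorphism.inj_iff[OF automorphism.intro[OF \<sigma>_pow[of j]]] by simp
    then have "\<sigma> ^^ (k - j) = id"
      by (intro automorphism_eqI \<sigma>_pow field_automorphism_id) auto
    with \<sigma>(2) have "p dvd k - j" by blast
    with jk show False by (auto dest: dvd_imp_le)
  qed
qed auto

lemma conjugate_eq:
  assumes "field_automorphism K \<tau>"
  shows "\<tau> x ^ p - y ^ (p - 1) * \<tau> x = \<beta>"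
proof -
  interpret automorphism K \<tau> by (rule automorphism.intro) fact
  have "\<tau> (x ^ p - y ^ (p - 1) * x) = \<tau> x ^ p - \<tau> (y ^ (p - 1)) * \<tau> x"
    by (simp del: power add: power[of x])
  then show ?thesis
    using x \<beta>(1) y(2) by (simp add: fixed del: diff mult power)
qed

text \<open>The defining polynomial has coefficients in \<open>K\<close>, so every conjugate of
  \<open>x\<close> is a root of it. Its degree is at most \<open>p\<close>, and the iterates of
  \<sigma> already give \<open>p\<close> distinct roots.\<close>

lemma conjugate_of_x:
  assumes "field_automorphism K \<tau>"
  obtains j where "j < p" "\<tau> x = (\<sigma> ^^ j) x"
proof -
  define q where "q = Polynomial.monom 1 p - Polynomial.monom (y ^ (p - 1)) 1 - [:\<beta>:]"
  have "Polynomial.coeff q p = 1"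
    using p_gt_2 by (cases p) (auto simp: q_def coeff_pCons split: nat.splits)
  then have q0: "q \<noteq> 0" by auto
  have "Polynomial.degree q \<le> p"
    unfolding q_def using p_gt_2
    by (intro degree_diff_le) (auto intro!: order.trans[OF degree_monom_le])
  with card_poly_roots_bound[OF q0] have card: "card {z. poly q z = 0} \<le> p" by simp
  have root: "poly q (\<tau>' x) = 0" if "field_automorphism K \<tau>'" for \<tau>'
    using conjugate_eq[OF that] by (simp add: q_def poly_monom)
  have "(\<lambda>j. (\<sigma> ^^ j) x) ` {..<p} = {z. poly q z = 0}"
    by (rule card_seteq) (use poly_roots_finite[OF q0] root[OF \<sigma>_pow] card \<sigma>_pow_x_inj in
        \<open>auto simp: card_image\<close>)
  with root[OF assms] that show thesis by auto
qed

text \<open>As \<open>y ^ (p - 1)\<close> lies in \<open>K\<close>, the quotient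
  \<open>\<tau> y / y\<close> is a root of unity of order dividing \<open>p - 1\<close>.\<close>

lemma conjugate_of_y:
  assumes "field_automorphism K \<tau>"
  obtains a where "\<tau> y = \<rho> ^ a * y"
proof -
  interpret automorphism K \<tau> by (rule automorphism.intro) fact
  have "\<tau> y ^ (p - 1) = y ^ (p - 1)"
    using fixed[OF y(2)] by simp
  then have "(\<tau> y / y) ^ (p - 1) = 1"
    using y(1) by (simp add: power_divide)
  then obtain a where "\<tau> y / y = \<rho> ^ a"
    using unity_root_is_power[OF \<rho>(2)] by blast
  then show thesis
    using y(1) by (intro that[of a]) (simp add: field_simps)
qed

text \<open>\<open>fixed_by_stabilizer a\<close> says that \<open>a\<close> is fixed by \<open>Gal(M/L)\<close>, where \<open>L = K(x)\<close>.\<close>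

definition fixed_by_stabilizer :: "'a \<Rightarrow> bool" where
  "fixed_by_stabilizer a \<longleftrightarrow> (\<forall>\<tau>. field_automorphism K \<tau> \<longrightarrow> \<tau> x = x \<longrightarrow> \<tau> a = a)"

lemma subfield_set_fixed_by_stabilizer: "subfield_set {a. fixed_by_stabilizer a}"
proof -
  have eq: "{a. fixed_by_stabilizer a} = \<Inter> ((\<lambda>\<tau>. {a. \<tau> a = a}) ` {\<tau>. field_automorphism K \<tau> \<and> \<tau> x = x})"
    by (auto simp: fixed_by_stabilizer_def)
  have "subfield_set {a. \<tau> a = a}" if "field_automorphism K \<tau>" for \<tau>
    by (rule automorphism.subfield_set_fixed[OF automorphism.intro[OF that]])
  then show ?thesis
    unfolding eq by (intro subfield_set_Inter) blast
qed

lemma adjoin_x_fixed: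
  assumes "a \<in> adjoin K {x}"
  shows "fixed_by_stabilizer a"
proof -
  have "K \<union> {x} \<subseteq> {a. fixed_by_stabilizer a}"
    by (auto simp: fixed_by_stabilizer_def field_automorphism_def)
  from adjoin_least[OF subfield_set_fixed_by_stabilizer this] assms show ?thesis by auto
qed

text \<open>The iterates \<open>\<sigma> ^^ j\<close> with \<open>j < p\<close> represent the cosets
  of the stabilizer of \<open>x\<close>, and the image of \<open>c\<close> depends only on the
  coset. So each \<tau> merely permutes the summands, and the sum lies in the fixed field.\<close>

lemma trace_mem:
  assumes c: "fixed_by_stabilizer c"
  shows "(\<Sum>j<p. (\<sigma> ^^ j) c) \<in> K"
proof (rule fixed_field)
  fix \<tau> assume \<tau>: "field_automorphism K \<tau>"
  interpret automorphism K \<tau> by (rule automorphism.intro) fact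
  have "\<exists>j'<p. \<tau> ((\<sigma> ^^ j) x) = (\<sigma> ^^ j') x" for j
    using conjugate_of_x[OF field_automorphism_comp[OF \<tau> \<sigma>_pow[of j]]] by auto
  then obtain \<pi> where \<pi>: "\<And>j. \<pi> j < p" "\<And>j. \<tau> ((\<sigma> ^^ j) x) = (\<sigma> ^^ \<pi> j) x"
    by metis
  have \<tau>_c: "\<tau> ((\<sigma> ^^ j) c) = (\<sigma> ^^ \<pi> j) c" for j
  proof -
    let ?s = "\<sigma> ^^ \<pi> j"
    \<comment> \<open>This automorphism fixes \<open>x\<close>, hence \<open>c\<close>: thus
      \<open>\<tau> \<circ> \<sigma> ^^ j\<close> and \<open>\<sigma> ^^ \<pi> j\<close> agree on
      \<open>c\<close>.\<close>
    let ?\<tau>' = "inv_into UNIV ?s \<circ> (\<tau> \<circ> \<sigma> ^^ j)"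
    have \<tau>': "field_automorphism K ?\<tau>'"
      by (intro field_automorphism_comp field_automorphism_inv \<tau> \<sigma>_pow)
    have s: "inj ?s" "surj ?s"
      using \<sigma>_pow[of "\<pi> j"] by (auto simp: field_automorphism_def bij_is_inj bij_is_surj)
    have "?\<tau>' x = x"
      using \<pi>(2)[of j] s by simp
    with \<tau>' c have "?\<tau>' c = c"
      unfolding fixed_by_stabilizer_def by blast
    then show ?thesis
      using surj_f_inv_f[OF s(2), of "\<tau> ((\<sigma> ^^ j) c)"] by simp
  qed
  have inj: "inj_on \<pi> {..<p}"
  proof (rule inj_onI)
    fix j k assume jk: "j \<in> {..<p}" "k \<in> {..<p}" "\<pi> j = \<pi> k"
    then have "\<tau> ((\<sigma> ^^ j) x) = \<tau> ((\<sigma> ^^ k) x)"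
      by (simp only: \<pi>(2))
    then have "(\<sigma> ^^ j) x = (\<sigma> ^^ k) x"
      by (simp only: inj_iff)
    with jk \<sigma>_pow_x_inj show "j = k" by (auto dest: inj_onD)
  qed
  have "\<pi> ` {..<p} = {..<p}"
    by (rule endo_inj_surj) (use \<pi>(1) inj in auto)
  then have "(\<Sum>j<p. (\<sigma> ^^ j) c) = (\<Sum>j<p. (\<sigma> ^^ \<pi> j) c)"
    using sum.reindex[OF inj, of "\<lambda>j. (\<sigma> ^^ j) c"] by simp
  then show "\<tau> (\<Sum>j<p. (\<sigma> ^^ j) c) = (\<Sum>j<p. (\<sigma> ^^ j) c)"
    unfolding sum \<tau>_c by (rule sym)
qed

text \<open>Dual basis argument: with \<open>P(X) = X\<^sup>p - y\<^bsup>p-1\<^esup>X - \<beta>\<close> and \<open>Q(X,Z) = (P(X) - P(Z)) / (X - Z)\<close>,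
  the value \<open>Q(x, \<sigma>\<^sup>j x)\<close> is \<open>P'(x)\<close> for \<open>j = 0\<close> and \<open>0\<close> for \<open>0 < j < p\<close>, so that
  \<open>P'(x) a = (\<Sum>\<^sub>j \<sigma>\<^sup>j a Q(x, \<sigma>\<^sup>j x))\<close> is a polynomial in \<open>x\<close> whose coefficients are traces.\<close>

lemma fixed_by_stabilizer_expansion:
  assumes a: "fixed_by_stabilizer a"
  obtains c where "\<And>m. c m \<in> K"
    "a * (of_nat p * x ^ (p - 1) - y ^ (p - 1)) = (\<Sum>m<p. c m * x ^ m)"
proof -
  interpret F: subfield_set "{a. fixed_by_stabilizer a}" by (rule subfield_set_fixed_by_stabilizer)
  define tr where "tr c = (\<Sum>j<p. (\<sigma> ^^ j) c)" for c
  have fixed_x: "fixed_by_stabilizer x"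
    by (simp add: fixed_by_stabilizer_def)
  have tr: "tr (a * x ^ n) \<in> K" for n
    unfolding tr_def by (rule trace_mem) (use F.mult_mem[of a "x ^ n"] F.power_mem[of x] a fixed_x in simp)
  \<comment> \<open>The coefficient of \<open>x ^ m\<close> in the sum of
    \<open>(\<sigma> ^^ j) a * Q ((\<sigma> ^^ j) x)\<close>; the constant
    \<open>- (y ^ (p - 1))\<close> in \<open>Q\<close> contributes to \<open>m = 0\<close>
    only.\<close>
  define c where "c m = tr (a * x ^ (p - Suc m)) - (if m = 0 then y ^ (p - 1) * tr a else 0)" for m
  define Q where "Q z = (\<Sum>m<p. z ^ (p - Suc m) * x ^ m) - y ^ (p - 1)" for z
  have Q0: "Q ((\<sigma> ^^ j) x) = 0" if "j < p" "j \<noteq> 0" for j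
  proof -
    let ?z = "(\<sigma> ^^ j) x"
    have "x \<noteq> ?z"
      using inj_onD[OF \<sigma>_pow_x_inj, of 0 j] that by auto
    moreover have "(x - ?z) * Q ?z = (x ^ p - y ^ (p - 1) * x) - (?z ^ p - y ^ (p - 1) * ?z)"
      by (simp add: Q_def right_diff_distrib left_diff_distrib power_diff_sumr2 mult.commute)
    ultimately show ?thesis
      using conjugate_eq[OF \<sigma>_pow[of j]] x by simp
  qed
  have "x ^ (p - Suc m) * x ^ m = x ^ (p - 1)" if "m < p" for m
    using that by (simp flip: power_add)
  then have Qx: "Q x = of_nat p * x ^ (p - 1) - y ^ (p - 1)"
    by (simp add: Q_def)
  have "(\<Sum>m<p. c m * x ^ m) = (\<Sum>m<p. tr (a * x ^ (p - Suc m)) * x ^ m) - y ^ (p - 1) * tr a"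
    using p_gt_2 by (simp add: c_def left_diff_distrib sum_subtractf if_distrib[of "\<lambda>u. u * _"] sum.delta
        cong: if_cong)
  also have "\<dots> = (\<Sum>m<p. \<Sum>j<p. (\<sigma> ^^ j) a * ((\<sigma> ^^ j) x ^ (p - Suc m) * x ^ m)) - (\<Sum>j<p. (\<sigma> ^^ j) a * y ^ (p - 1))"
    by (simp add: tr_def sum_distrib_right sum_distrib_left mult_ac
        automorphism.mult[OF automorphism.intro[OF \<sigma>_pow]] automorphism.power[OF automorphism.intro[OF \<sigma>_pow]])
  also have "(\<Sum>m<p. \<Sum>j<p. (\<sigma> ^^ j) a * ((\<sigma> ^^ j) x ^ (p - Suc m) * x ^ m)) =
      (\<Sum>j<p. \<Sum>m<p. (\<sigma> ^^ j) a * ((\<sigma> ^^ j) x ^ (p - Suc m) * x ^ m))"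
    by (rule sum.swap)
  also have "\<dots> - (\<Sum>j<p. (\<sigma> ^^ j) a * y ^ (p - 1)) = (\<Sum>j<p. (\<sigma> ^^ j) a * Q ((\<sigma> ^^ j) x))"
    by (simp add: Q_def right_diff_distrib sum_subtractf sum_distrib_left)
  also have "\<dots> = (\<Sum>j\<in>{0}. (\<sigma> ^^ j) a * Q ((\<sigma> ^^ j) x))"
    using p_gt_2 Q0 by (intro sum.mono_neutral_right) auto
  finally have "a * (of_nat p * x ^ (p - 1) - y ^ (p - 1)) = (\<Sum>m<p. c m * x ^ m)"
    by (simp add: Qx)
  moreover have "c m \<in> K" for m
    using tr[of "p - Suc m"] tr[of 0] y(2) by (auto simp: c_def intro: diff_mem mult_mem)
  ultimately show thesis using that by blast
qed

text \<open>The Galois correspondence for \<open>K(x)\<close>: the expansion is divided by the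
  derivative at \<open>x\<close>, which is nonzero by \<open>separable\<close> and lies in
  \<open>K(x)\<close>.\<close>

lemma fixed_by_stabilizer_iff: "fixed_by_stabilizer a \<longleftrightarrow> a \<in> adjoin K {x}"
proof
  interpret L: subfield_set "adjoin K {x}" by (rule subfield_set_adjoin)
  have K: "K \<subseteq> adjoin K {x}" and x_mem: "x \<in> adjoin K {x}"
    using adjoin_superset[of K "{x}"] by auto
  assume "fixed_by_stabilizer a"
  then obtain c where c: "\<And>m. c m \<in> K"
    "a * (of_nat p * x ^ (p - 1) - y ^ (p - 1)) = (\<Sum>m<p. c m * x ^ m)"
    using fixed_by_stabilizer_expansion by blast
  define D where "D = of_nat p * x ^ (p - 1) - y ^ (p - 1)"
  have "D \<in> adjoin K {x}"
    unfolding D_def using K y(2) by (intro L.diff_mem L.mult_mem L.power_mem[OF x_mem]) auto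
  moreover have "(\<Sum>m<p. c m * x ^ m) \<in> adjoin K {x}"
    using c(1) K by (intro L.sum_mem L.mult_mem L.power_mem x_mem) auto
  moreover have "a = (\<Sum>m<p. c m * x ^ m) / D"
    using separable c(2) by (simp add: D_def field_simps)
  ultimately show "a \<in> adjoin K {x}"
    using L.divide_mem by simp
qed (rule adjoin_x_fixed)

text \<open>The expansion is applied to both \<open>1\<close> and \<open>a\<close>: the derivative
  \<open>?D\<close> and \<open>a * ?D\<close> each have the absolute value of a monomial, and the
  quotient of the two gives that of \<open>a\<close> without evaluating \<open>?D\<close>.\<close>

lemma N_adjoin_x:
  assumes distinct: "\<And>m m' c c'. \<lbrakk>m < p; m' < p; m \<noteq> m'; c \<in> K - {0}; c' \<in> K - {0}\<rbrakk>
      \<Longrightarrow> N (c * x ^ m) \<noteq> N (c' * x ^ m')"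
    and a: "a \<in> adjoin K {x}" "a \<noteq> 0"
  shows "\<exists>c\<in>K - {0}. \<exists>c'\<in>K - {0}. \<exists>m m'. N (a * (c * x ^ m)) = N (c' * x ^ m')"
proof -
  let ?D = "of_nat p * x ^ (p - 1) - y ^ (p - 1)"
  have D: "?D \<noteq> 0"
    using separable by (simp only: right_minus_eq) simp
  have val: "\<exists>m. \<exists>c\<in>K - {0}. N (\<Sum>m<p. c' m * x ^ m) = N (c * x ^ m)"
    if c': "\<And>m. c' m \<in> K" and "(\<Sum>m<p. c' m * x ^ m) \<noteq> 0" for c'
  proof -
    have "\<exists>m<p. c' m * x ^ m \<noteq> 0 \<and> N (\<Sum>m<p. c' m * x ^ m) = N (c' m * x ^ m)"
      by (rule N_sum_eq_summand) (use that distinct in auto)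
    then show ?thesis using c' by fastforce
  qed
  have one: "fixed_by_stabilizer 1"
    by (simp add: fixed_by_stabilizer_def field_automorphism_def)
  obtain c1 where c1: "\<And>m. c1 m \<in> K" "1 * ?D = (\<Sum>m<p. c1 m * x ^ m)"
    using fixed_by_stabilizer_expansion[OF one] by blast
  obtain c2 where c2: "\<And>m. c2 m \<in> K" "a * ?D = (\<Sum>m<p. c2 m * x ^ m)"
    using fixed_by_stabilizer_expansion a(1) fixed_by_stabilizer_iff by blast
  obtain m c where c: "c \<in> K - {0}" "N ?D = N (c * x ^ m)"
    using val[of c1] c1 D by auto
  obtain m' c' where c': "c' \<in> K - {0}" "N (a * ?D) = N (c' * x ^ m')"
    using val[of c2] c2 D a(2) by (auto simp flip: c2(2))
  have "N (a * (c * x ^ m)) = N (a * ?D)"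
    by (simp only: N_mult[of a] c(2))
  with c c' show ?thesis by auto
qed

end

text \<open>\<open>T\<close> is one common bound for all three sources of error: \<open>p\<close>,
  \<Delta> and \<open>\<rho> - of_nat r\<close>. The value \<open>T = 0\<close> is allowed and makes
  every estimate an equality.\<close>

locale artin_schreier_approx = artin_schreier_like N K p \<sigma> x y \<Delta> \<beta> \<rho>
  for N :: "'a::field \<Rightarrow> real" and K p \<sigma> x y \<Delta> \<beta> \<rho> +
  fixes r :: nat and T :: real
  assumes residue_char: "\<And>n. N (of_nat n) < 1 \<longleftrightarrow> p dvd n"
    and T: "0 \<le> T" "T < 1" "N (of_nat p) \<le> T" "N \<Delta> \<le> T" "N (\<rho> - of_nat r) \<le> T"
    and r: "residue_primroot p r"
begin

text \<open>Each further application of \<sigma> adds \<open>y * (1 + \<Delta>)\<close> and replaces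
  \<delta> by \<open>\<sigma> \<delta>\<close>, which has the same absolute value.\<close>

lemma \<sigma>_pow_x: "\<exists>\<delta>. N \<delta> \<le> T \<and> (\<sigma> ^^ n) x = x + y * (of_nat n + \<delta>)"
proof (induction n)
  case 0
  then show ?case using T(1) by (intro exI[of _ 0]) simp
next
  case (Suc n)
  then obtain \<delta> where \<delta>: "N \<delta> \<le> T" "(\<sigma> ^^ n) x = x + y * (of_nat n + \<delta>)"
    by blast
  then show ?case
    using T(4) by (intro exI[of _ "\<sigma> \<delta> + \<Delta>"]) (auto intro: N_add_le simp: \<sigma>_x \<sigma>_y algebra_simps)
qed

lemma N_\<rho> [simp]: "N \<rho> = 1"
  using power_eq_imp_eq_base[of "N \<rho>" "p - 1" 1] \<rho>_root(2) p_gt_2 by (simp flip: N_power)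

lemma N_\<rho>_power_diff: "N (\<rho> ^ k - of_nat (r ^ k)) \<le> T"
  using N_power_diff_le[of \<rho> "of_nat r" k] T(5) by simp

lemma \<sigma>_pow_r_x: "\<exists>\<epsilon>. N \<epsilon> \<le> T \<and> (\<sigma> ^^ (r ^ k)) x = x + y * (\<rho> ^ k + \<epsilon>)"
proof -
  obtain \<delta> where \<delta>: "N \<delta> \<le> T" "(\<sigma> ^^ (r ^ k)) x = x + y * (of_nat (r ^ k) + \<delta>)"
    using \<sigma>_pow_x by blast
  then show ?thesis
    using N_\<rho>_power_diff[of k]
    by (intro exI[of _ "\<delta> - (\<rho> ^ k - of_nat (r ^ k))"]) (simp add: N_diff_le)
qed

lemma \<sigma>_pow_cong:
  assumes "[i = j] (mod p)"
  shows "\<sigma> ^^ i = \<sigma> ^^ j"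
proof -
  have "\<sigma> ^^ k = \<sigma> ^^ (k mod p)" for k
  proof -
    have "\<sigma> ^^ k = \<sigma> ^^ (p * (k div p)) \<circ> \<sigma> ^^ (k mod p)"
      by (simp flip: funpow_add)
    also have "\<sigma> ^^ (p * (k div p)) = id"
      using \<sigma>(2)[of "p * (k div p)"] by simp
    finally show ?thesis by simp
  qed
  from this[of i] this[of j] assms show ?thesis
    by (simp add: cong_def)
qed

text \<open>The operator \<Psi> as a plain function on \<open>M\<close>;
  \<open>group_ring_act_Psi\<close> makes the link to the group ring.\<close>

definition psi :: "'a \<Rightarrow> 'a" where
  "psi a = - (1 / y) * (\<Sum>k<p - 1. inverse \<rho> ^ k * (\<sigma> ^^ (r ^ k)) a)"

lemma psi_1: "psi 1 = 0"
proof -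
  have "(\<sigma> ^^ n) 1 = 1" for n
    using \<sigma>_pow[of n] by (simp add: field_automorphism_def)
  then show ?thesis
    using sum_inverse_powers_unity_root[OF \<rho>(2), of 0] p_gt_2 by (simp add: psi_def)
qed

lemma N_psi_diff_le:
  assumes i: "1 \<le> i" "i \<le> p - 1"
  shows "N (psi (x ^ i) - of_nat i * x ^ (i - 1)) \<le> N x ^ (i - 1) * T"
proof -
  obtain \<epsilon> where \<epsilon>: "\<And>k. N (\<epsilon> k) \<le> T" "\<And>k. (\<sigma> ^^ (r ^ k)) x = x + y * (\<rho> ^ k + \<epsilon> k)"
    using \<sigma>_pow_r_x by metis
  define S where "S m = (\<Sum>k<p - 1. inverse \<rho> ^ k * (\<rho> ^ k + \<epsilon> k) ^ m)" for m
  \<comment> \<open>With exact powers of \<rho>, \<open>S 1\<close> would be \<open>p - 1\<close>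
    and every other \<open>S m\<close> zero. Adding 1 at \<open>m = 1\<close> leaves only small
    quantities and splits off the main term \<open>i * x ^ (i - 1)\<close>.\<close>
  define F where "F m = S m + (if m = 1 then 1 else 0)" for m
  have geom: "(\<Sum>k<p - 1. inverse \<rho> ^ k * \<rho> ^ (k * m)) = (if m = 1 then of_nat p - 1 else 0)" if "m \<le> i" for m
    using sum_inverse_powers_unity_root[OF \<rho>(2), of m] that i p_gt_2 by (simp add: of_nat_diff)
  have "N (F m) \<le> T" if "m \<le> i" for m
  proof -
    have "N ((\<rho> ^ k + \<epsilon> k) ^ m - (\<rho> ^ k) ^ m) \<le> T" for k
      using N_power_diff_le[of "\<rho> ^ k + \<epsilon> k" "\<rho> ^ k" m] \<epsilon>(1)[of k] T(2) N_add_le[of "\<rho> ^ k" 1 "\<epsilon> k"]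
      by (simp add: N_power)
    then have "N (\<Sum>k<p - 1. inverse \<rho> ^ k * ((\<rho> ^ k + \<epsilon> k) ^ m - (\<rho> ^ k) ^ m)) \<le> T"
      using T(1) by (intro N_sum_le) (simp_all add: N_mult N_power N_inverse)
    also have "(\<Sum>k<p - 1. inverse \<rho> ^ k * ((\<rho> ^ k + \<epsilon> k) ^ m - (\<rho> ^ k) ^ m)) =
        S m - (if m = 1 then of_nat p - 1 else 0)"
      unfolding geom[OF that, symmetric]
      by (simp add: S_def right_diff_distrib sum_subtractf power_mult)
    finally have "N (S m - (if m = 1 then of_nat p - 1 else 0) + (if m = 1 then of_nat p else 0)) \<le> T"
      using T(1,3) by (intro N_add_le) auto
    then show ?thesis by (simp add: F_def split: if_splits)
  qed
  \<comment> \<open>The term \<open>m = 0\<close> carries the factor \<open>1 / y\<close>, so it has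
    to vanish exactly; a bound by \<open>T\<close> would not suffice.\<close>
  moreover have "F 0 = 0"
    using geom[of 0] by (simp add: F_def S_def)
  ultimately have F: "N (F m) \<le> (if m = 0 then 0 else T)" if "m \<le> i" for m
    using that by simp
  have "psi (x ^ i) = - (1 / y) * (\<Sum>k<p - 1. inverse \<rho> ^ k * (y * (\<rho> ^ k + \<epsilon> k) + x) ^ i)"
    by (simp add: psi_def \<epsilon>(2) automorphism.power[OF automorphism.intro[OF \<sigma>_pow]] add.commute)
  also have "\<dots> = - (1 / y) * (\<Sum>k<p - 1. \<Sum>m\<le>i. of_nat (i choose m) * x ^ (i - m) * y ^ m *
      (inverse \<rho> ^ k * (\<rho> ^ k + \<epsilon> k) ^ m))"
    by (simp add: binomial_ring sum_distrib_left power_mult_distrib mult_ac)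
  also have "\<dots> = - (1 / y) * (\<Sum>m\<le>i. of_nat (i choose m) * x ^ (i - m) * y ^ m * S m)"
    unfolding S_def sum_distrib_left by (subst sum.swap) simp
  finally have psi: "psi (x ^ i) = - (1 / y) * (\<Sum>m\<le>i. of_nat (i choose m) * x ^ (i - m) * y ^ m * S m)" .
  have "(\<Sum>m\<le>i. of_nat (i choose m) * x ^ (i - m) * y ^ m * (if m = 1 then 1 else 0)) =
      (\<Sum>m\<in>{1}. of_nat (i choose m) * x ^ (i - m) * y ^ m)"
    using i by (intro sum.mono_neutral_cong_right) auto
  then have "psi (x ^ i) - of_nat i * x ^ (i - 1) =
      - (1 / y) * (\<Sum>m\<le>i. of_nat (i choose m) * x ^ (i - m) * y ^ m * F m)"
    using y(1) unfolding psi F_def distrib_left sum.distrib by simp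
  also have "\<dots> = (\<Sum>m\<le>i. - (of_nat (i choose m) * x ^ (i - m) * (y ^ m / y) * F m))"
    by (simp add: sum_distrib_left sum_negf)
  also have "N \<dots> \<le> N x ^ (i - 1) * T"
  proof (rule N_sum_le)
    fix m assume m: "m \<in> {..i}"
    show "N (- (of_nat (i choose m) * x ^ (i - m) * (y ^ m / y) * F m)) \<le> N x ^ (i - 1) * T"
    proof (cases "m = 0")
      case True
      then show ?thesis using F[of m] m T(1) by (simp add: order_antisym_conv)
    next
      case False
      \<comment> \<open>After the division by \<open>y\<close> there remain \<open>m - 1\<close>
        factors \<open>y\<close>, each exchanged for the larger \<open>x\<close>; together with
        \<open>x ^ (i - m)\<close> they give \<open>x ^ (i - 1)\<close>.\<close>
      then have "N (y ^ m / y) = N y ^ (m - 1)"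
        using y(1) by (cases m) (simp_all add: N_power)
      also have "\<dots> \<le> N x ^ (m - 1)"
        using artin_schreier_root(1)[OF x \<beta>(2)] p_gt_2 by (intro power_mono) auto
      finally have "N (x ^ (i - m)) * N (y ^ m / y) \<le> N x ^ (i - m) * N x ^ (m - 1)"
        by (intro mult_mono) (auto simp: N_power)
      also have "\<dots> = N x ^ (i - 1)"
        using False m by (simp flip: power_add)
      finally have "N (of_nat (i choose m)) * (N (x ^ (i - m)) * N (y ^ m / y)) * N (F m) \<le> 1 * N x ^ (i - 1) * T"
        using F[of m] m False by (intro mult_mono) auto
      then show ?thesis by (simp only: N_minus N_mult mult.assoc mult_1_left)
    qed
  qed (use T(1) in simp)
  finally show ?thesis .
qed

lemma fixed_by_stabilizer_psi:
  assumes c: "fixed_by_stabilizer c"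
  shows "fixed_by_stabilizer (psi c)"
  unfolding fixed_by_stabilizer_def
proof (intro allI impI)
  fix \<tau> assume \<tau>: "field_automorphism K \<tau>" and \<tau>_x: "\<tau> x = x"
  interpret automorphism K \<tau> by (rule automorphism.intro) fact
  let ?\<tau>' = "inv_into UNIV \<tau>"
  have \<tau>': "field_automorphism K ?\<tau>'"
    by (rule field_automorphism_inv[OF \<tau>])
  have inv: "\<tau> (?\<tau>' z) = z" "?\<tau>' (\<tau> z) = z" for z
    using bij by (simp_all add: bij_is_inj bij_is_surj surj_f_inv_f)
  have \<tau>'_x: "?\<tau>' x = x"
    using inv(2)[of x] \<tau>_x by simp
  obtain a where a: "\<tau> y = \<rho> ^ a * y"
    using conjugate_of_y[OF \<tau>] .
  obtain b where b: "?\<tau>' y = \<rho> ^ b * y"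
    using conjugate_of_y[OF \<tau>'] .
  have \<sigma>_\<rho>: "\<sigma> (\<rho> ^ n) = \<rho> ^ n" for n
    using \<sigma>.fixed[OF power_mem[OF \<rho>(1)]] .
  have \<tau>_\<rho>: "\<tau> \<rho> = \<rho>"
    by (rule fixed[OF \<rho>(1)])
  let ?s = "\<tau> \<circ> (\<sigma> \<circ> ?\<tau>')"
  have s: "field_automorphism K ?s"
    by (intro field_automorphism_comp \<tau> \<tau>' \<sigma>)
  then obtain j where j: "?s x = (\<sigma> ^^ j) x"
    using conjugate_of_x by blast
  \<comment> \<open>The conjugate of \<open>y\<close> is a multiple of \<open>y\<close> by an
    element of \<open>K\<close>, hence fixed by \<sigma>. So \<open>?s\<close> fixes
    \<open>y\<close>, as every iterate of \<sigma> does, and \<open>x\<close> alone decides which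
    iterate it is.\<close>
  have "\<sigma> (?\<tau>' y) = ?\<tau>' y"
    by (simp only: b \<sigma>.mult \<sigma>_\<rho> \<sigma>_y)
  then have "?s y = (\<sigma> ^^ j) y"
    by (simp add: inv)
  with s j have s_eq: "?s = \<sigma> ^^ j"
    by (intro automorphism_eqI \<sigma>_pow)
  obtain \<delta> where \<delta>: "N \<delta> \<le> T" "(\<sigma> ^^ j) x = x + y * (of_nat j + \<delta>)"
    using \<sigma>_pow_x by blast
  \<comment> \<open>Two expressions for the same conjugate of \<open>x\<close> give
    \<open>\<rho> ^ a * (1 + \<tau> \<Delta>) = of_nat j + \<delta>\<close>; since \<rho> is close
    to \<open>r\<close>, this determines \<open>j\<close> modulo \<open>p\<close>.\<close>
  have "?s x = x + \<rho> ^ a * y + \<rho> ^ a * y * \<tau> \<Delta>"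
    by (simp add: \<tau>'_x \<sigma>_x \<tau>_x a)
  with j \<delta>(2) have "y * (\<rho> ^ a * (1 + \<tau> \<Delta>)) = y * (of_nat j + \<delta>)"
    by (simp add: algebra_simps)
  then have "\<rho> ^ a * (1 + \<tau> \<Delta>) = of_nat j + \<delta>"
    using y(1) by simp
  then have eq: "of_nat j - of_nat (r ^ a) = (\<rho> ^ a - of_nat (r ^ a)) + (\<rho> ^ a * \<tau> \<Delta> - \<delta>)"
    by (simp add: algebra_simps)
  have "N (\<rho> ^ a * \<tau> \<Delta>) \<le> T"
    using T(4) by (simp add: N_mult N_power N_automorphism[OF \<tau> finite_dimension])
  then have "N (of_nat j - of_nat (r ^ a)) \<le> T"
    unfolding eq by (intro N_add_le N_diff_le N_\<rho>_power_diff \<delta>)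
  then have "[j = r ^ a] (mod p)"
    using T(2) by (intro cong_if_N_diff_less_1[OF residue_char]) auto
  with s_eq have s_eq': "?s = \<sigma> ^^ (r ^ a)"
    using \<sigma>_pow_cong by simp
  have comm: "\<tau> ((\<sigma> ^^ n) z) = (\<sigma> ^^ (n * r ^ a)) (\<tau> z)" for n z
  proof (induction n)
    case (Suc n)
    have "\<tau> ((\<sigma> ^^ Suc n) z) = ?s (\<tau> ((\<sigma> ^^ n) z))"
      by (simp add: inv)
    also have "\<dots> = (\<sigma> ^^ (r ^ a)) ((\<sigma> ^^ (n * r ^ a)) (\<tau> z))"
      unfolding s_eq' Suc ..
    also have "\<dots> = (\<sigma> ^^ (r ^ a + n * r ^ a)) (\<tau> z)"
      by (simp only: funpow_add comp_apply)
    finally show ?case by simp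
  qed simp
  define g where "g k = inverse \<rho> ^ k * (\<sigma> ^^ (r ^ k)) c" for k
  have \<tau>_c: "\<tau> c = c"
    using c \<tau> \<tau>_x by (simp add: fixed_by_stabilizer_def)
  have "\<tau> (psi c) = - (1 / (\<rho> ^ a * y)) * (\<Sum>k<p - 1. inverse \<rho> ^ k * (\<sigma> ^^ (r ^ k * r ^ a)) c)"
    by (simp add: psi_def sum a comm \<tau>_\<rho> \<tau>_c)
  \<comment> \<open>The factor \<open>inverse \<rho> ^ a\<close> from \<open>1 / \<tau> y\<close>
    completes \<open>inverse \<rho> ^ k\<close> to the coefficient of index
    \<open>k + a\<close>.\<close>
  also have "\<dots> = - (1 / y) * (\<Sum>k<p - 1. g (k + a))"
    by (simp add: g_def sum_distrib_left power_add divide_inverse power_inverse mult_ac)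
  also have "(\<Sum>k<p - 1. g (k + a)) = (\<Sum>k<p - 1. g k)"
  proof (rule sum_mod_shift)
    fix k
    have "[r ^ totient p = 1] (mod p)"
      using r by (intro euler_theorem) (auto simp: residue_primroot_def coprime_commute)
    then have "[r ^ k * r ^ (p - 1) = r ^ k * 1] (mod p)"
      using p(1) by (intro cong_mult) (auto simp: totient_prime)
    then have "\<sigma> ^^ (r ^ (k + (p - 1))) = \<sigma> ^^ (r ^ k)"
      by (intro \<sigma>_pow_cong) (simp add: power_add)
    then show "g (k + (p - 1)) = g k"
      by (simp only: g_def power_inverse \<rho>_root(4))
  qed
  finally show "\<tau> (psi c) = psi c"
    by (simp add: psi_def g_def)
qed

lemma psi_mem: "psi (x ^ i) \<in> adjoin K {x}"
proof -
  interpret F: subfield_set "{a. fixed_by_stabilizer a}" by (rule subfield_set_fixed_by_stabilizer)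
  have "fixed_by_stabilizer (x ^ i)"
    using F.power_mem[of x i] by (simp add: fixed_by_stabilizer_def)
  then show ?thesis
    using fixed_by_stabilizer_psi fixed_by_stabilizer_iff by blast
qed

end

text \<open>Summing over one finite set \<open>S\<close> that contains all keys and all iterates
  covers coinciding iterates and vanishing coefficients alike.\<close>

lemma group_ring_act_Psi:
  assumes "2 \<le> p"
  shows "group_ring_act (Psi p \<sigma> y \<rho> r) a =
    - (1 / y) * (\<Sum>k<p - 1. inverse \<rho> ^ k * (\<sigma> ^^ (r ^ k)) a)"
proof -
  let ?\<xi> = "Psi p \<sigma> y \<rho> r"
  define S where "S = Poly_Mapping.keys ?\<xi> \<union> (\<lambda>k. \<sigma> ^^ (r ^ k)) ` {..<p - 1}"
  have fin: "finite S"
    by (simp add: S_def)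
  have range: "{0..p - 2} = {..<p - 1}"
    using assms by auto
  have lookup: "Poly_Mapping.lookup ?\<xi> \<tau> =
      - (1 / y) * (\<Sum>k<p - 1. inverse \<rho> ^ k when \<sigma> ^^ (r ^ k) = \<tau>)" for \<tau>
    unfolding Psi_def range
    by (simp add: Poly_Mapping.map.rep_eq lookup_sum lookup_single power_int_minus power_inverse when_def)
  have "group_ring_act ?\<xi> a = (\<Sum>\<tau>\<in>S. Poly_Mapping.lookup ?\<xi> \<tau> * \<tau> a)"
    unfolding group_ring_act_def using fin
    by (intro sum.mono_neutral_left) (auto simp: S_def in_keys_iff)
  also have "\<dots> = - (1 / y) * (\<Sum>\<tau>\<in>S. \<Sum>k<p - 1. if \<sigma> ^^ (r ^ k) = \<tau> then inverse \<rho> ^ k * \<tau> a else 0)"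
    by (auto simp: lookup sum_distrib_left sum_distrib_right when_def intro!: sum.cong)
  also have "(\<Sum>\<tau>\<in>S. \<Sum>k<p - 1. if \<sigma> ^^ (r ^ k) = \<tau> then inverse \<rho> ^ k * \<tau> a else 0) =
      (\<Sum>k<p - 1. \<Sum>\<tau>\<in>S. if \<sigma> ^^ (r ^ k) = \<tau> then inverse \<rho> ^ k * \<tau> a else 0)"
    by (rule sum.swap)
  also have "\<dots> = (\<Sum>k<p - 1. inverse \<rho> ^ k * (\<sigma> ^^ (r ^ k)) a)"
    using fin by (intro sum.cong refl) (simp add: S_def)
  finally show ?thesis .
qed

section \<open>Discrete valuations\<close>

lemma normalized_valuation_integral:
  assumes "normalized_valuation F v" "a \<in> F" "a \<noteq> 0"
  obtains n :: int where "v a = ereal (real_of_int n)"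
proof -
  have "v a \<in> range (\<lambda>n::int. ereal (real_of_int n))"
    using assms unfolding normalized_valuation_def by blast
  then show thesis using that by blast
qed

lemma normalized_valuation_1:
  assumes "normalized_valuation F v" "1 \<in> F"
  shows "v 1 = 0"
proof -
  obtain n where n: "v 1 = ereal (real_of_int n)"
    using normalized_valuation_integral[OF assms] by auto
  have "v (1 * 1) = v 1 + v 1"
    using assms unfolding normalized_valuation_def by blast
  with n show ?thesis by simp
qed

text \<open>The \<open>n\<close>-fold sum of the unit of the quotient ring is the coset of
  \<open>n\<close>, which is zero iff \<open>n\<close> lies in the maximal ideal. Integrality of the
  values makes \<open>1 \<le> v\<close> the same as \<open>0 < v\<close>.\<close>

lemma residue_char_valuation:
  assumes F: "subfield_set F" and v: "normalized_valuation F v" and p: "residue_char F v p"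
  shows "0 < v (of_nat n) \<longleftrightarrow> p dvd n"
proof -
  interpret subfield_set F by fact
  let ?P = "prime_power_ideal F v 1" and ?R = "residue_field F v"
  have add: "v (a + b) \<ge> min (v a) (v b)" if "a \<in> F" "b \<in> F" for a b
    using v that unfolding normalized_valuation_def by blast
  have v_mult: "v (a * b) = v a + v b" if "a \<in> F" "b \<in> F" for a b
    using v that unfolding normalized_valuation_def by blast
  have P_add: "a + b \<in> ?P" if "a \<in> ?P" "b \<in> ?P" for a b
    using that add[of a b] by (auto simp: prime_power_ideal_def add_mem intro: order.trans[of _ "min (v a) (v b)"])
  have P_0: "0 \<in> ?P"
    using v by (simp add: prime_power_ideal_def normalized_valuation_def)
  have coset: "[n] \<cdot>\<^bsub>?R\<^esub> \<one>\<^bsub>?R\<^esub> = (\<lambda>a. a + of_nat n) ` ?P" for n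
  proof (induction n)
    case 0
    then show ?case by (simp add: add_pow_def nat_pow_def residue_field_def FactRing_def)
  next
    case (Suc n)
    have "[Suc n] \<cdot>\<^bsub>?R\<^esub> \<one>\<^bsub>?R\<^esub> = [n] \<cdot>\<^bsub>?R\<^esub> \<one>\<^bsub>?R\<^esub> \<oplus>\<^bsub>?R\<^esub> \<one>\<^bsub>?R\<^esub>"
      by (simp add: add_pow_def nat_pow_def)
    also have "\<dots> = (\<Union>a\<in>?P. \<Union>b\<in>?P. {a + of_nat n + (b + 1)})"
      unfolding Suc
      by (auto simp: residue_field_def FactRing_def set_add_def' a_r_coset_def' integer_ring_def)
    also have "\<dots> = (\<lambda>a. a + of_nat (Suc n)) ` ?P"
    proof (intro equalityI subsetI)
      fix z assume "z \<in> (\<Union>a\<in>?P. \<Union>b\<in>?P. {a + of_nat n + (b + 1)})"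
      then obtain a b where "a \<in> ?P" "b \<in> ?P" "z = (a + b) + of_nat (Suc n)"
        by (auto simp: algebra_simps)
      then show "z \<in> (\<lambda>a. a + of_nat (Suc n)) ` ?P"
        using P_add by blast
    next
      fix z assume "z \<in> (\<lambda>a. a + of_nat (Suc n)) ` ?P"
      then obtain a where "a \<in> ?P" "z = a + of_nat n + (0 + 1)"
        by (auto simp: algebra_simps)
      then show "z \<in> (\<Union>a\<in>?P. \<Union>b\<in>?P. {a + of_nat n + (b + 1)})"
        using P_0 by blast
    qed
    finally show ?case .
  qed
  have "v 1 = 0"
    by (rule normalized_valuation_1[OF v one_mem])
  have v_neg_1: "v (- 1) = 0"
  proof -
    obtain n where n: "v (- 1) = ereal (real_of_int n)"
      using normalized_valuation_integral[OF v minus_mem[OF one_mem]] by auto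
    have "v (- 1 * - 1) = v (- 1) + v (- 1)"
      by (intro v_mult minus_mem one_mem)
    with n \<open>v 1 = 0\<close> show ?thesis by simp
  qed
  have P_neg: "- a \<in> ?P" if "a \<in> ?P" for a
    using that v_mult[OF minus_mem[OF one_mem], of a] v_neg_1 by (auto simp: prime_power_ideal_def minus_mem)
  have "(\<lambda>a. a + of_nat n) ` ?P = ?P \<longleftrightarrow> of_nat n \<in> ?P"
  proof
    assume "(\<lambda>a. a + of_nat n) ` ?P = ?P"
    moreover have "0 + of_nat n \<in> (\<lambda>a. a + of_nat n) ` ?P"
      using P_0 by blast
    ultimately show "of_nat n \<in> ?P" by simp
  next
    assume n: "of_nat n \<in> ?P"
    show "(\<lambda>a. a + of_nat n) ` ?P = ?P"
    proof (intro equalityI subsetI)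
      fix z assume "z \<in> ?P"
      then have "z + - of_nat n \<in> ?P"
        by (intro P_add P_neg n)
      then show "z \<in> (\<lambda>a. a + of_nat n) ` ?P"
        by (intro image_eqI[of _ _ "z + - of_nat n"]) auto
    qed (use P_add n in auto)
  qed
  moreover have "\<zero>\<^bsub>?R\<^esub> = ?P"
    by (simp add: residue_field_def FactRing_def)
  moreover have "of_nat n \<in> ?P \<longleftrightarrow> 0 < v (of_nat n)"
  proof (cases "of_nat n = (0 :: 'a)")
    case True
    then show ?thesis using v P_0 by (simp add: normalized_valuation_def)
  next
    case False
    then obtain k where "v (of_nat n) = ereal (real_of_int k)"
      using normalized_valuation_integral[OF v of_nat_mem] by blast
    then show ?thesis by (simp add: prime_power_ideal_def) linarith
  qed
  ultimately show ?thesis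
    using p coset unfolding residue_char_def by metis
qed

text \<open>The base 2 is an arbitrary choice. Zero is separated because
  \<open>real_of_ereal\<close> sends \<infinity> to 0.\<close>

definition val_abs :: "('a::field \<Rightarrow> ereal) \<Rightarrow> 'a \<Rightarrow> real" where
  "val_abs v a = (if a = 0 then 0 else 2 powr (- real_of_ereal (v a)))"

locale valued_field =
  fixes v :: "'a::field \<Rightarrow> ereal"
  assumes v: "normalized_valuation UNIV v"
begin

text \<open>An integer copy of the valuation that permits divisibility arguments; at zero it has the
  default value 0.\<close>

definition w :: "'a \<Rightarrow> int" where
  "w a = \<lfloor>real_of_ereal (v a)\<rfloor>"

lemma v_0 [simp]: "v 0 = \<infinity>"
  using v by (simp add: normalized_valuation_def)

lemma v_eq_w: "a \<noteq> 0 \<Longrightarrow> v a = ereal (real_of_int (w a))"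
  using normalized_valuation_integral[OF v UNIV_I, of a "v a = ereal (real_of_int (w a))"]
  by (auto simp: w_def)

lemma v_mult: "v (a * b) = v a + v b" and v_add: "min (v a) (v b) \<le> v (a + b)"
  using v by (auto simp: normalized_valuation_def)

lemma w_mult: "a \<noteq> 0 \<Longrightarrow> b \<noteq> 0 \<Longrightarrow> w (a * b) = w a + w b"
  using v_mult[of a b] by (simp add: v_eq_w flip: of_int_add)

lemma w_1 [simp]: "w 1 = 0"
  using w_mult[of 1 1] by simp

lemma w_power: "a \<noteq> 0 \<Longrightarrow> w (a ^ n) = int n * w a"
  by (induction n) (simp_all add: w_mult algebra_simps)

lemma val_abs_eq: "a \<noteq> 0 \<Longrightarrow> val_abs v a = 2 powr (- real_of_int (w a))"
  by (simp add: val_abs_def v_eq_w)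

lemma val_abs_le_iff: "val_abs v a \<le> val_abs v b \<longleftrightarrow> v b \<le> v a"
  by (cases "a = 0"; cases "b = 0") (auto simp: val_abs_eq v_eq_w, simp_all add: val_abs_def not_le)

lemma val_abs_le_powr_iff: "val_abs v a \<le> 2 powr (- c) \<longleftrightarrow> ereal c \<le> v a"
  by (cases "a = 0") (auto simp: val_abs_eq v_eq_w, simp add: val_abs_def)

lemma val_abs_less_powr_iff: "val_abs v a < 2 powr (- c) \<longleftrightarrow> ereal c < v a"
  by (cases "a = 0") (auto simp: val_abs_eq v_eq_w, simp add: val_abs_def)

sublocale nonarch_abs "val_abs v"
proof
  show "val_abs v a = 0 \<longleftrightarrow> a = 0" "0 \<le> val_abs v a" for a
    by (simp_all add: val_abs_def)
  show "val_abs v (a * b) = val_abs v a * val_abs v b" for a b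
    by (cases "a = 0 \<or> b = 0") (auto simp: val_abs_def v_mult, simp add: v_eq_w flip: powr_add)
  show "val_abs v (a + b) \<le> max (val_abs v a) (val_abs v b)" for a b
    using v_add[of a b] by (simp add: le_max_iff_disj val_abs_le_iff min_le_iff_disj)
qed

lemma val_abs_less_1_iff: "val_abs v a < 1 \<longleftrightarrow> 0 < v a"
  using val_abs_less_powr_iff[of a 0] by (simp add: zero_ereal_def)

lemma val_abs_le_1_iff: "val_abs v a \<le> 1 \<longleftrightarrow> 0 \<le> v a"
  using val_abs_le_powr_iff[of a 0] by (simp add: zero_ereal_def)

lemma val_abs_less_iff: "val_abs v a < val_abs v b \<longleftrightarrow> v b < v a"
  using val_abs_le_iff[of b a] by (simp add: not_le[symmetric])

lemma val_abs_eq_iff: "a \<noteq> 0 \<Longrightarrow> b \<noteq> 0 \<Longrightarrow> val_abs v a = val_abs v b \<longleftrightarrow> w a = w b"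
  using powr_inj[of 2 "- real_of_int (w a)" "- real_of_int (w b)"] by (simp add: val_abs_eq)

text \<open>On \<open>K\<close> the two valuations differ by the positive factor \<open>E\<close>,
  so they have the same Cauchy and convergent sequences.\<close>

lemma complete_subfield_if_complete_wrt:
  assumes K: "subfield_set K" and complete: "complete_wrt K vK"
    and E: "0 < E" "\<And>a. a \<in> K \<Longrightarrow> v a = ereal E * vK a"
  shows "complete_subfield (val_abs v) K"
proof -
  interpret subfield_set K by fact
  have iff: "ereal c \<le> vK a \<longleftrightarrow> val_abs v a \<le> 2 powr (- (E * c))" if "a \<in> K" for a c
    unfolding val_abs_le_powr_iff E(2)[OF that] using E(1)
    by (cases "vK a") (simp_all add: mult_le_cancel_left)
  show ?thesis
  proof
    fix a :: "nat \<Rightarrow> 'a"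
    assume a: "\<And>n. a n \<in> K"
      and Cauchy: "\<And>\<epsilon>. 0 < \<epsilon> \<Longrightarrow> \<exists>n0. \<forall>m\<ge>n0. \<forall>n\<ge>n0. val_abs v (a m - a n) < \<epsilon>"
    have "\<exists>n0. \<forall>m\<ge>n0. \<forall>n\<ge>n0. ereal (real C) \<le> vK (a m - a n)" for C :: nat
    proof -
      have "0 < 2 powr (- (E * C))" by simp
      then obtain n0 where "\<forall>m\<ge>n0. \<forall>n\<ge>n0. val_abs v (a m - a n) < 2 powr (- (E * C))"
        using Cauchy by blast
      then show ?thesis
        using iff[OF diff_mem[OF a a]] by (meson less_imp_le)
    qed
    then obtain l where l: "l \<in> K" "\<And>C::nat. \<exists>n0. \<forall>n\<ge>n0. ereal (real C) \<le> vK (a n - l)"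
      using complete a unfolding complete_wrt_def by blast
    have "(\<lambda>n. val_abs v (a n - l)) \<longlonglongrightarrow> 0"
    proof (rule order_tendstoI)
      fix \<epsilon> :: real assume "0 < \<epsilon>"
      obtain C :: nat where "- log 2 \<epsilon> / E < real C"
        using reals_Archimedean2 by blast
      then have "2 powr (- (E * C)) < \<epsilon>"
        using E(1) \<open>0 < \<epsilon>\<close> by (simp add: powr_less_iff field_simps)
      moreover obtain n0 where "\<forall>n\<ge>n0. ereal (real C) \<le> vK (a n - l)"
        using l(2) by blast
      ultimately show "\<forall>\<^sub>F n in sequentially. val_abs v (a n - l) < \<epsilon>"
        unfolding eventually_sequentially using iff[OF diff_mem[OF a l(1)]]
        by (intro exI[of _ n0]) (meson order.strict_trans1)
    qed (auto intro: always_eventually order.strict_trans2[OF _ N_nonneg])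
    with l(1) show "\<exists>l\<in>K. (\<lambda>n. val_abs v (a n - l)) \<longlonglongrightarrow> 0" by blast
  qed
qed

end

section \<open>The action of \<open>\<Psi>\<close> on powers of \<open>x\<close>\<close>

theorem theorem3p3:
  fixes p d e f t r0 :: nat
    and b :: int
    and l :: real
    and K L :: "'m::field set"
    and vK vL vM :: "'m \<Rightarrow> ereal"
    and x y \<alpha> \<beta> \<pi> \<gamma> \<mu> \<Delta> \<rho>0 :: 'm
    and \<sigma> :: "'m \<Rightarrow> 'm"
  assumes p: "Factorial_Ring.prime p" "p \<noteq> 2"
    and K: "complete_discretely_valued_field K vK"
      "finite (carrier (residue_field K vK))" "residue_char K vK p"
    and vL: "valuation_of_extension K vK L vL"
    and vM: "valuation_of_extension L vL UNIV vM"
    and L: "typical_extension p K vK L vL" "L = adjoin K {x}"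
    and x: "x ^ p - \<alpha> ^ ((p - 1) div d) * x = \<beta>"
    and d: "d = e * f" "d dvd p - 1"
    and t: "t < e" "coprime t e"
    and b: "coprime b (int p)"
    and l: "l = real_of_int b + real p * real t / real e"
      "0 < l" "ereal l < vL (of_nat p) / ereal (real p - 1)"
    and \<beta>: "\<beta> \<in> K" "vK \<beta> = ereal (- real_of_int b)"
    and \<alpha>: "\<alpha> = \<pi> ^ (f * t) * \<gamma> ^ f * \<mu>"
      "prime_element K vK \<pi>" "\<gamma> \<in> valuation_units K vK" "\<mu> \<in> valuation_units K vK"
      "residue_coset_order K vK f \<mu> = f"
    and M: "adjoin K {x, y} = UNIV" "y ^ d = \<alpha>" "galois_closure K L UNIV"
    and ram: "ramification_number K UNIV vM l"
    and \<sigma>: "\<sigma> \<in> carrier (galois_group K UNIV)" "group.ord (galois_group K UNIV) \<sigma> = p"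
      "\<sigma> y = y" "\<sigma> x = x + y + y * \<Delta>"
    and \<Delta>: "CHAR('m) = p \<Longrightarrow> \<Delta> = 0"
      "CHAR('m) = 0 \<Longrightarrow> vM \<Delta> = vM (of_nat p) - ereal ((real p - 1) * real e * l)"
    and r0: "residue_primroot p r0"
    and \<rho>0: "CHAR('m) = p \<Longrightarrow> \<rho>0 = of_nat r0"
      "CHAR('m) = 0 \<Longrightarrow> teichmueller_rep p K vK r0 \<rho>0"
  shows "group_ring_act (Psi p \<sigma> y \<rho>0 r0) 1 = 0 \<and>
    (\<forall>i\<in>{1..p - 1}.
       group_ring_act (Psi p \<sigma> y \<rho>0 r0) (x ^ i) \<in> L \<and>
       (CHAR('m) = p \<longrightarrow>
          group_ring_act (Psi p \<sigma> y \<rho>0 r0) (x ^ i) = of_nat i * x ^ (i - 1)) \<and>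
       (CHAR('m) = 0 \<longrightarrow>
          group_ring_act (Psi p \<sigma> y \<rho>0 r0) (x ^ i) - of_nat i * x ^ (i - 1)
            \<in> (\<lambda>u. x ^ (i - 1) * u) `
                prime_power_ideal L vL (vL (of_nat p) - ereal ((real p - 1) * l))))"
proof -

  \<comment> \<open>The valuations of \<open>K\<close>, \<open>L\<close> and \<open>M\<close> and
    their indices\<close>
  note p_gt_2 = prime_gt_1_nat[OF p(1)] p(2)
  have p2: "2 < p" using p_gt_2 by linarith
  have nvK: "normalized_valuation K vK" and K_complete: "complete_wrt K vK"
    using K(1) by (auto simp: complete_discretely_valued_field_def)
  interpret K: subfield_set K
    using K(1) by (intro subfield_set_of_subfield) (simp add: complete_discretely_valued_field_def)
  have KL: "K \<subseteq> L"
    using L(1) by (simp add: typical_extension_def)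
  interpret L: subfield_set L
    using L(1) by (intro subfield_set_of_subfield) (simp add: typical_extension_def)
  have nvL: "normalized_valuation L vL"
    using vL by (simp add: valuation_of_extension_def)
  obtain eL where eL: "0 < eL" "\<And>a. a \<in> K \<Longrightarrow> a \<noteq> 0 \<Longrightarrow> vL a = ereal (real eL) * vK a"
    using vL by (auto simp: valuation_of_extension_def lies_over_with_index_def)
  interpret V: valued_field vM
    using vM by unfold_locales (simp add: valuation_of_extension_def)
  obtain eM where eM: "0 < eM" "\<And>a. a \<in> L \<Longrightarrow> a \<noteq> 0 \<Longrightarrow> vM a = ereal (real eM) * vL a"
    using vM by (auto simp: valuation_of_extension_def lies_over_with_index_def)
  define E where "E = eM * eL"
  have E: "0 < E" using eL eM by (simp add: E_def)
  have vM_K: "vM a = ereal (real E) * vK a" if "a \<in> K" for a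
  proof (cases "a = 0")
    case True
    then show ?thesis using nvK E by (simp add: normalized_valuation_def)
  next
    case False
    then show ?thesis
      using that KL by (subst eM(2)) (auto simp: eL(2) E_def mult.assoc[symmetric])
  qed
  have w_K: "real_of_int (V.w a) = real E * c" if "a \<in> K" "a \<noteq> 0" "vK a = ereal c" for a c
    using vM_K[OF that(1)] V.v_eq_w[OF that(2)] that(3) by simp
  have w_K_mult: "\<exists>n. V.w a = int E * n" if a: "a \<in> K" "a \<noteq> 0" for a
  proof -
    obtain n where "vK a = ereal (real_of_int n)"
      using normalized_valuation_integral[OF nvK a] .
    from w_K[OF a this] have "real_of_int (V.w a) = real_of_int (int E * n)" by simp
    then show ?thesis by (metis of_int_eq_iff)
  qed
  have w_L: "real_of_int (V.w a) = real eM * c" if "a \<in> L" "a \<noteq> 0" "vL a = ereal c" for a c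
    using eM(2)[OF that(1,2)] V.v_eq_w[OF that(2)] that(3) by simp
  interpret C: complete_subfield "val_abs vM" K
    by (rule V.complete_subfield_if_complete_wrt[OF K.subfield_set_axioms K_complete, of "real E"])
      (use E vM_K in auto)

  \<comment> \<open>Residue characteristic and characteristic\<close>
  have residue: "val_abs vM (of_nat n) < 1 \<longleftrightarrow> p dvd n" for n
  proof -
    have "0 < ereal (real E) * vK (of_nat n) \<longleftrightarrow> 0 < vK (of_nat n)"
      using E by (cases "vK (of_nat n)") (auto simp: zero_less_mult_iff)
    then show ?thesis
      using residue_char_valuation[OF K.subfield_set_axioms nvK K(3), of n]
      by (simp add: V.val_abs_less_1_iff vM_K)
  qed
  have char: "CHAR('m) = 0 \<or> CHAR('m) = p"
  proof -
    \<comment> \<open>The image of \<open>CHAR('m)\<close> is zero, hence of absolute value below 1.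
      A positive characteristic is prime and therefore equals \<open>p\<close>.\<close>
    have "p dvd CHAR('m)"
      using residue[of "CHAR('m)"] by simp
    then show ?thesis
      using p(1) prime_CHAR_semidom[where ?'a = 'm] by (metis neq0_conv primes_dvd_imp_eq)
  qed

  \<comment> \<open>Valuations of \<alpha>, \<beta>, \<open>y\<close> and \<open>x\<close> in
    \<open>M\<close>\<close>
  have pos: "0 < e" "0 < d" "0 < f"
    using t(1) d p2 by (auto intro!: Nat.gr0I)
  have unit: "u \<in> K \<and> u \<noteq> 0 \<and> V.w u = 0" if "u \<in> valuation_units K vK" for u
  proof -
    from that obtain u' where u: "u \<in> K" "u' \<in> K" "0 \<le> vK u" "0 \<le> vK u'" "u * u' = 1"
      by (auto simp: valuation_units_def valuation_ring_def)
    then have nz: "u \<noteq> 0" "u' \<noteq> 0" by auto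
    have nonneg: "0 \<le> V.w a" if a: "a \<in> K" "a \<noteq> 0" "0 \<le> vK a" for a
    proof -
      obtain n where n: "vK a = ereal (real_of_int n)"
        using normalized_valuation_integral[OF nvK a(1,2)] .
      have "0 \<le> real_of_int (V.w a)"
        using w_K[OF a(1,2) n] n a(3) by simp
      then show ?thesis by simp
    qed
    have "V.w u + V.w u' = 0"
      using V.w_mult[OF nz] u(5) by simp
    with nonneg[of u] nonneg[of u'] u nz show ?thesis by auto
  qed
  have \<pi>: "\<pi> \<in> K" "\<pi> \<noteq> 0" "V.w \<pi> = int E"
  proof -
    show 1: "\<pi> \<in> K" and 2: "\<pi> \<noteq> 0"
      using \<alpha>(2) nvK by (auto simp: prime_element_def normalized_valuation_def)
    have "vK \<pi> = ereal 1"
      using \<alpha>(2) by (simp add: prime_element_def)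
    from w_K[OF 1 2 this] show "V.w \<pi> = int E"
      by (metis mult.right_neutral of_int_eq_iff of_int_of_nat_eq)
  qed
  have \<alpha>_K: "\<alpha> \<in> K" "\<alpha> \<noteq> 0" "V.w \<alpha> = int (f * t) * int E"
    using unit[OF \<alpha>(3)] unit[OF \<alpha>(4)] \<pi> unfolding \<alpha>(1)
    by (auto intro!: K.mult_mem K.power_mem simp: V.w_mult V.w_power)
  have y: "y \<noteq> 0"
    using M(2) \<alpha>_K(2) pos by auto
  have "int d * V.w y = int (f * t) * int E"
    using V.w_power[OF y, of d] M(2) \<alpha>_K(3) by simp
  \<comment> \<open>Since \<open>d = e * f\<close>, the factor \<open>f\<close> cancels: measured by
    the valuation of \<open>K\<close>, \<open>y\<close> has value \<open>t / e\<close>.\<close>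
  then have w_y: "int e * V.w y = int t * int E"
    using pos d(1) by simp
  have y_pow: "\<alpha> ^ ((p - 1) div d) = y ^ (p - 1)"
    using d(2) by (simp flip: M(2) power_mult)
  have y_pow_K: "y ^ (p - 1) \<in> K"
    unfolding y_pow[symmetric] by (rule K.power_mem[OF \<alpha>_K(1)])
  have x_eq: "x ^ p - y ^ (p - 1) * x = \<beta>"
    using x y_pow by simp
  have \<beta>_nz: "\<beta> \<noteq> 0"
    using \<beta>(2) nvK by (auto simp: normalized_valuation_def)
  have w_\<beta>: "V.w \<beta> = - int E * b"
  proof -
    have "real_of_int (V.w \<beta>) = real_of_int (- int E * b)"
      using w_K[OF \<beta>(1) \<beta>_nz \<beta>(2)] by simp
    then show ?thesis by (simp only: of_int_eq_iff)
  qed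
  \<comment> \<open>This is the condition \<open>0 < l\<close>, cleared of its denominator
    \<open>e\<close> and multiplied by \<open>E\<close>.\<close>
  have N_y_\<beta>: "val_abs vM y ^ p < val_abs vM \<beta>"
  proof -
    have "l * real e = real_of_int (b * int e + int p * int t)"
      using pos by (simp add: l(1) distrib_right)
    moreover have "0 < l * real e"
      using l(2) pos by simp
    ultimately have "0 < b * int e + int p * int t"
      by (simp only: of_int_0_less_iff)
    then have "0 < int E * (b * int e + int p * int t)"
      using E by simp
    also have "\<dots> = int e * (int E * b) + int p * (int t * int E)"
      by (simp add: algebra_simps)
    also have "\<dots> = int e * (int E * b + int p * V.w y)"
      by (simp add: distrib_left flip: w_y)
    finally have "0 < int e * (int E * b + int p * V.w y)" .
    then have "V.w \<beta> < V.w (y ^ p)"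
      using pos by (simp add: w_\<beta> V.w_power y zero_less_mult_iff)
    then have "val_abs vM (y ^ p) < val_abs vM \<beta>"
      using y \<beta>_nz by (simp add: V.val_abs_less_iff V.v_eq_w)
    then show ?thesis by (simp add: V.N_power)
  qed
  have x_nz: "x \<noteq> 0"
    using x_eq \<beta>_nz p2 by (auto simp: power_0_left)
  have w_x: "int p * V.w x = - int E * b"
  proof -
    have "val_abs vM \<beta> = val_abs vM (x ^ p)"
      using V.artin_schreier_root(2)[OF x_eq N_y_\<beta>] p2 by (simp add: V.N_power)
    then show ?thesis
      using x_nz \<beta>_nz w_\<beta> by (simp add: V.val_abs_eq_iff V.w_power)
  qed
  have "coprime (int p) b"
    using b by (simp add: coprime_commute)
  \<comment> \<open>\<open>p\<close> and \<open>y ^ (p - 1)\<close> lie in \<open>K\<close>, so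
    their values are multiples of \<open>E\<close>. Equality, combined with
    \<open>p * V.w x = - E * b\<close>, would make \<open>V.w x\<close> a multiple of
    \<open>E\<close> and hence \<open>b\<close> a multiple of \<open>p\<close>.\<close>
  have separable: "of_nat p * x ^ (p - 1) \<noteq> y ^ (p - 1)"
  proof
    assume eq: "of_nat p * x ^ (p - 1) = y ^ (p - 1)"
    then have p_nz: "of_nat p \<noteq> (0 :: 'm)"
      using y by auto
    obtain n where n: "V.w (of_nat p) = int E * n"
      using w_K_mult[OF K.of_nat_mem p_nz] by blast
    obtain n' where n': "V.w (y ^ (p - 1)) = int E * n'"
      using w_K_mult[OF y_pow_K] y by auto
    have "V.w (of_nat p * x ^ (p - 1)) = V.w (of_nat p) + (int p - 1) * V.w x"
      using p_nz x_nz p2 by (simp add: V.w_mult V.w_power of_nat_diff)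
    then have "V.w (of_nat p) + (int p - 1) * V.w x = V.w (y ^ (p - 1))"
      by (simp only: eq)
    then have wx: "V.w x = int E * (- b + n - n')"
      using n n' w_x by (simp add: algebra_simps)
    have "int E * (int p * (- b + n - n')) = int E * (- b)"
      using w_x unfolding wx by (simp only: mult.left_commute[of "int p"])
    then have "int p * (- b + n - n') = - b"
      using E by (simp only: mult_cancel_left) simp
    then have "int p dvd b"
      by (metis dvd_minus_iff dvd_triv_left)
    with \<open>coprime (int p) b\<close> p2 show False
      using coprime_absorb_left[of "int p" b] by auto
  qed

  \<comment> \<open>The Galois data and the primitive root of unity\<close>
  have \<sigma>_aut: "field_automorphism K \<sigma>"
    using \<sigma>(1) by (simp add: carrier_galois_group_UNIV)
  have \<rho>_K: "\<rho>0 \<in> K"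
    using char \<rho>0 by (auto simp: teichmueller_rep_def padic_integers_in_def)
  have \<rho>_root: "primitive_unity_root (p - 1) \<rho>0"
  proof (cases "CHAR('m) = 0")
    case True
    then show ?thesis using \<rho>0(2) by (simp add: teichmueller_rep_def)
  next
    case False
    then have char_p: "CHAR('m) = p" using char by auto
    have ord: "ord p r0 = p - 1"
      using r0 p(1) by (simp add: residue_primroot_def totient_prime)
    have "r0 ^ k \<noteq> 0" for k
      using r0 p2 by (cases "r0 = 0") (auto simp: residue_primroot_def)
    then have ge: "1 \<le> r0 ^ k" for k
      by (simp add: Suc_le_eq)
    \<comment> \<open>In characteristic \<open>p\<close> the order of \<open>r0\<close> modulo
      \<open>p\<close> carries over to \<open>M\<close>; positivity of \<open>r0 ^ k\<close> makes
      \<open>r0 ^ k - 1\<close> a true difference.\<close>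
    have iff: "(of_nat r0 :: 'm) ^ k = 1 \<longleftrightarrow> p - 1 dvd k" for k
    proof -
      have "(of_nat r0 :: 'm) ^ k = 1 \<longleftrightarrow> of_nat (r0 ^ k - 1) = (0 :: 'm)"
        using ge[of k] by (simp add: of_nat_diff)
      also have "\<dots> \<longleftrightarrow> p dvd r0 ^ k - 1"
        by (simp only: of_nat_eq_0_iff_char_dvd char_p)
      also have "\<dots> \<longleftrightarrow> [r0 ^ k = 1] (mod p)"
        using ge[of k] cong_altdef_nat[of 1 "r0 ^ k" p] by simp
      finally show ?thesis
        by (simp only: ord_divides ord)
    qed
    show ?thesis
      using p2 \<rho>0(1)[OF char_p] iff by (auto simp: primitive_unity_root_def dest: dvd_imp_le)
  qed

  interpret S: artin_schreier_like "val_abs vM" K p \<sigma> x y \<Delta> \<beta> \<rho>0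
  proof
    show "\<sigma> ^^ n = id \<longleftrightarrow> p dvd n" for n
      using funpow_eq_id_iff_ord_dvd[OF \<sigma>_aut] \<sigma>(2) by simp
    show "ring.finite_dimension amb K UNIV"
      using M(3) by (simp add: galois_closure_def galois_extension_def)
    show "a \<in> K" if "\<And>\<tau>. field_automorphism K \<tau> \<Longrightarrow> \<tau> a = a" for a
      using M(3) that by (auto simp: galois_closure_def galois_extension_def carrier_galois_group_UNIV)
  qed (fact p \<sigma>_aut M(1) \<sigma>(3,4) y y_pow_K x_eq \<beta>(1) N_y_\<beta> separable \<rho>_K \<rho>_root)+

  \<comment> \<open>Divisibility of the index of \<open>M/L\<close> by \<open>e\<close>\<close>
  have "int p dvd int E"
  proof -
    have "int p dvd int E * b"
      using w_x by (metis dvd_minus_iff dvd_triv_left mult_minus_left)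
    then show ?thesis
      using \<open>coprime (int p) b\<close> coprime_dvd_mult_left_iff by blast
  qed
  \<comment> \<open>Since \<open>V.w x = - g * b\<close> and \<open>E = p * g\<close>, every
    monomial in \<open>x\<close> over \<open>K\<close> has value divisible by \<open>g\<close>, and
    so does every nonzero element of \<open>L\<close>.\<close>
  then obtain g where g: "int E = int p * g" by blast
  have w_x': "V.w x = - g * b"
  proof -
    have "int p * V.w x = int p * (- g * b)"
      using w_x unfolding g by simp
    then show ?thesis
      using p2 by (simp only: mult_cancel_left) simp
  qed
  have g_pos: "0 < g"
  proof -
    have "0 < int p * g"
      using E by (simp flip: g)
    then show ?thesis
      using p2 by (simp add: zero_less_mult_iff)
  qed
  \<comment> \<open>Modulo \<open>E = p * g\<close> the value of \<open>c * x ^ m\<close> is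
    \<open>- m * g * b\<close>; as \<open>b\<close> is prime to \<open>p\<close>, it determines
    \<open>m\<close> modulo \<open>p\<close>.\<close>
  have distinct: "val_abs vM (c * x ^ m) \<noteq> val_abs vM (c' * x ^ m')"
    if m: "m < p" "m' < p" "m \<noteq> m'" and c: "c \<in> K - {0}" "c' \<in> K - {0}" for c c' m m'
  proof
    assume "val_abs vM (c * x ^ m) = val_abs vM (c' * x ^ m')"
    then have eq: "V.w c + int m * V.w x = V.w c' + int m' * V.w x"
      using c x_nz by (simp add: V.val_abs_eq_iff V.w_mult V.w_power)
    obtain n n' where "V.w c = int E * n" "V.w c' = int E * n'"
      using w_K_mult c by blast
    with eq have "g * (b * (int m - int m')) = g * (int p * (n - n'))"
      by (simp add: w_x' g algebra_simps)
    then have "b * (int m - int m') = int p * (n - n')"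
      using g_pos by simp
    then have "int p dvd int m - int m'"
      using \<open>coprime (int p) b\<close> by (metis coprime_dvd_mult_right_iff dvd_triv_left)
    then have "int m mod int p = int m' mod int p"
      by (simp add: mod_eq_dvd_iff)
    with m show False by simp
  qed
  have g_dvd: "g dvd V.w a" if a: "a \<in> L" "a \<noteq> 0" for a
  proof -
    obtain c c' m m' where c: "c \<in> K - {0}" "c' \<in> K - {0}"
      and eq: "val_abs vM (a * (c * x ^ m)) = val_abs vM (c' * x ^ m')"
      using S.N_adjoin_x[OF distinct] a L(2) by blast
    from eq c a x_nz have "V.w a = V.w c' + int m' * V.w x - V.w c - int m * V.w x"
      by (simp add: V.val_abs_eq_iff V.w_mult V.w_power)
    moreover obtain n n' where "V.w c = int E * n" "V.w c' = int E * n'"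
      using w_K_mult c by blast
    ultimately have "V.w a = g * (int p * n' - int m' * b - int p * n + int m * b)"
      by (simp add: w_x' g algebra_simps)
    then show ?thesis by simp
  qed
  \<comment> \<open>A prime element of \<open>L\<close> has value \<open>eM\<close> in
    \<open>M\<close>, so \<open>g\<close> divides \<open>eM\<close>, and
    \<open>eM * eL = p * g\<close> forces \<open>eL\<close> to divide \<open>p\<close>. Since
    \<open>e\<close> divides \<open>p - 1\<close>, it is prime to \<open>eL\<close>;
    \<open>w_y\<close> gives that \<open>e\<close> divides \<open>E = eM * eL\<close>.\<close>
  have "e dvd eM"
  proof -
    have "ereal 1 \<in> range (\<lambda>n::int. ereal (real_of_int n))"
      by (rule image_eqI[of _ _ 1]) simp_all
    also have "\<dots> = vL ` (L - {0})"
      using nvL[unfolded normalized_valuation_def, THEN conjunct2, THEN conjunct1] by (rule sym)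
    finally obtain a where a': "ereal 1 = vL a" "a \<in> L - {0}"
      by (rule imageE)
    then have a: "a \<in> L" "a \<noteq> 0" "vL a = ereal 1"
      by auto
    have "V.w a = int eM"
      using w_L[OF a] by (metis mult.right_neutral of_int_eq_iff of_int_of_nat_eq)
    then have "g dvd int eM"
      using g_dvd[OF a(1,2)] by simp
    then obtain h where h: "int eM = g * h" by blast
    have "g * (h * int eL) = g * int p"
      using g h by (simp add: E_def algebra_simps)
    then have "h * int eL = int p"
      using g_pos by simp
    then have "eL dvd p"
      by (metis dvd_triv_right int_dvd_int_iff)
    moreover have "coprime e p"
    proof -
      have "e dvd p - 1"
        using d by auto
      then have "\<not> p dvd e"
        using p2 pos by (auto dest!: dvd_imp_le)
      then show ?thesis
        using p(1) prime_imp_coprime coprime_commute by blast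
    qed
    ultimately have "coprime e eL"
      by (meson coprime_divisors dvd_refl)
    moreover have "e dvd t * E"
      using w_y by (metis dvd_triv_left int_dvd_int_iff of_nat_mult)
    then have "e dvd eM * eL"
      using t(2) by (simp add: E_def coprime_dvd_mult_right_iff coprime_commute)
    ultimately show "e dvd eM"
      by (simp add: coprime_dvd_mult_left_iff)
  qed
  then have e_le: "e \<le> eM"
    using eM(1) by (rule dvd_imp_le)

  \<comment> \<open>The common error bound in both characteristics\<close>
  obtain T D where T: "0 \<le> T" "T < 1" "val_abs vM (of_nat p) \<le> T" "val_abs vM \<Delta> \<le> T"
    and T_p: "CHAR('m) = p \<Longrightarrow> T = 0"
    and T_0: "CHAR('m) = 0 \<Longrightarrow> T = 2 powr (- D) \<and>
      ereal (real eM) * (vL (of_nat p) - ereal ((real p - 1) * l)) \<le> ereal D"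
  proof (cases "CHAR('m) = 0")
    case True
    have p_nz: "of_nat p \<noteq> (0 :: 'm)"
      using p2 by (simp add: of_nat_eq_0_iff_char_dvd True)
    obtain n where n: "vL (of_nat p) = ereal (real_of_int n)"
      using normalized_valuation_integral[OF nvL L.of_nat_mem p_nz] .
    have vM_p: "vM (of_nat p) = ereal (real eM * real_of_int n)"
      using eM(2)[OF L.of_nat_mem p_nz] n by simp
    \<comment> \<open>\<open>D\<close> is the value of \<Delta> in \<open>M\<close>. The upper bound
      on \<open>l\<close> and \<open>e \<le> eM\<close> make it positive; \<open>e \<le> eM\<close>
      also gives the comparison with the exponent formed with \<open>vL\<close>.\<close>
    define D where "D = real eM * real_of_int n - (real p - 1) * real e * l"
    have vM_\<Delta>: "vM \<Delta> = ereal D"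
      using \<Delta>(2)[OF True] vM_p by (simp add: D_def)
    have less: "(real p - 1) * l < real_of_int n"
      using l(3) p2 by (simp add: n pos_less_divide_eq mult.commute)
    have le: "(real p - 1) * real e * l \<le> real eM * ((real p - 1) * l)"
      using mult_right_mono[of "real e" "real eM" "(real p - 1) * l"] e_le l(2) p2
      by (simp add: mult_ac)
    have "real eM * ((real p - 1) * l) < real eM * real_of_int n"
      using less eM(1) by simp
    with le have D_pos: "0 < D"
      by (simp add: D_def)
    have D_le: "D \<le> real eM * real_of_int n"
      using l(2) p2 by (simp add: D_def)
    show thesis
    proof (rule that[of "2 powr (- D)" D])
      show "2 powr (- D) < 1"
        using D_pos powr_less_cancel_iff[of 2 "- D" 0] by simp
      show "val_abs vM (of_nat p) \<le> 2 powr (- D)" "val_abs vM \<Delta> \<le> 2 powr (- D)"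
        using D_le by (simp_all add: V.val_abs_le_powr_iff vM_p vM_\<Delta>)
      show "2 powr (- D) = 2 powr (- D) \<and>
          ereal (real eM) * (vL (of_nat p) - ereal ((real p - 1) * l)) \<le> ereal D"
        using le by (simp add: n D_def right_diff_distrib)
    qed (use True p2 in auto)
  next
    case False
    then have char_p: "CHAR('m) = p" using char by auto
    show thesis
    \<comment> \<open>Here \<open>D = 0\<close> is a placeholder: the property \<open>T_0\<close>
      concerns characteristic 0 only.\<close>
    proof (rule that[of 0 0])
      have "of_nat p = (0 :: 'm)"
        by (simp add: of_nat_eq_0_iff_char_dvd char_p)
      then show "val_abs vM (of_nat p) \<le> 0" by simp
      show "val_abs vM \<Delta> \<le> 0"
        using \<Delta>(1)[OF char_p] by simp
    qed (use False in auto)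
  qed
  have \<rho>_r0: "val_abs vM (\<rho>0 - of_nat r0) \<le> T"
  proof (cases "CHAR('m) = 0")
    case True
    then obtain c where c: "c \<in> padic_integers_in K vK" "\<rho>0 - of_nat r0 = of_nat p * c"
      using \<rho>0(2) by (auto simp: teichmueller_rep_def)
    \<comment> \<open>Approximation to precision 0 is enough: \<open>c\<close> differs from an
      integer by an integral element, hence is integral.\<close>
    then have "c \<in> K" "\<exists>z. ereal (real 0) \<le> vK (c - of_int z)"
      unfolding padic_integers_in_def by blast+
    then obtain z where z: "c \<in> K" "0 \<le> vK (c - of_int z)"
      by (auto simp: zero_ereal_def)
    have "0 \<le> vM (c - of_int z)"
      using vM_K[OF K.diff_mem[OF z(1) K.of_int_mem]] z(2) by simp
    then have "val_abs vM ((c - of_int z) + of_int z) \<le> 1"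
      by (intro V.N_add_le V.N_of_int) (simp add: V.val_abs_le_1_iff)
    then have "val_abs vM (of_nat p) * val_abs vM c \<le> T * 1"
      using T(1,3) by (intro mult_mono) auto
    then show ?thesis
      by (simp add: c(2) V.N_mult)
  next
    case False
    then show ?thesis
      using char \<rho>0(1) T(1) by auto
  qed

  \<comment> \<open>From the estimate in \<open>M\<close> to the action of \<Psi> and the ideal of
    \<open>L\<close>\<close>
  interpret A: artin_schreier_approx "val_abs vM" K p \<sigma> x y \<Delta> \<beta> \<rho>0 r0 T
    by unfold_locales (fact residue T \<rho>_r0 r0)+
  have act: "group_ring_act (Psi p \<sigma> y \<rho>0 r0) a = A.psi a" for a
    using group_ring_act_Psi[of p] p2 by (simp add: A.psi_def)
  have x_L: "x \<in> L"
    unfolding L(2) using adjoin_superset[of K "{x}"] by auto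
  have approx: "A.psi (x ^ i) - of_nat i * x ^ (i - 1) \<in> (\<lambda>u. x ^ (i - 1) * u) `
      prime_power_ideal L vL (vL (of_nat p) - ereal ((real p - 1) * l))"
    if i: "i \<in> {1..p - 1}" and char_0: "CHAR('m) = 0" for i
  proof (rule image_eqI)
    define u where "u = (A.psi (x ^ i) - of_nat i * x ^ (i - 1)) / x ^ (i - 1)"
    show "A.psi (x ^ i) - of_nat i * x ^ (i - 1) = x ^ (i - 1) * u"
      using x_nz by (simp add: u_def)
    have u_L: "u \<in> L"
      unfolding u_def using A.psi_mem[of i] L(2)
      by (intro L.divide_mem L.diff_mem L.mult_mem L.power_mem[OF x_L]) auto
    have "val_abs vM (A.psi (x ^ i) - of_nat i * x ^ (i - 1)) \<le> val_abs vM x ^ (i - 1) * T"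
      using A.N_psi_diff_le[of i] i by simp
    then have "val_abs vM u \<le> T"
      using V.N_pos[OF x_nz] by (simp add: u_def V.N_divide V.N_power pos_divide_le_eq mult.commute)
    then have D_le: "ereal D \<le> vM u"
      using T_0[OF char_0] by (simp add: V.val_abs_le_powr_iff)
    have "vL (of_nat p) - ereal ((real p - 1) * l) \<le> vL u"
    proof (cases "u = 0")
      case True
      then show ?thesis using nvL by (simp add: normalized_valuation_def)
    next
      case False
      have "ereal (real eM) * (vL (of_nat p) - ereal ((real p - 1) * l)) \<le> ereal (real eM) * vL u"
        using T_0[OF char_0] D_le eM(2)[OF u_L False] by (metis order.trans)
      then show ?thesis
        using eM(1) by (simp add: ereal_mult_le_mult_iff)
    qed
    with u_L show "u \<in> prime_power_ideal L vL (vL (of_nat p) - ereal ((real p - 1) * l))"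
      by (simp add: prime_power_ideal_def)
  qed
  have exact: "A.psi (x ^ i) = of_nat i * x ^ (i - 1)" if "i \<in> {1..p - 1}" "CHAR('m) = p" for i
  proof -
    have "val_abs vM (A.psi (x ^ i) - of_nat i * x ^ (i - 1)) \<le> 0"
      using A.N_psi_diff_le[of i] that T_p by simp
    then have "val_abs vM (A.psi (x ^ i) - of_nat i * x ^ (i - 1)) = 0"
      using V.N_nonneg by (intro antisym)
    then show ?thesis by simp
  qed
  show ?thesis
    unfolding act using A.psi_1 A.psi_mem L(2) approx exact by blast
qed

end
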